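(* Let $(\mathcal T,\eta,\mu,\tau)$ be a strong monad on $\mathbf{Set}$ (with respect to the cartesian product), with right strength $\tau'$. For each set $X$ let $$\mathcal Z X=\{t\in\mathcal TX \mid \forall \text{ sets } Y,\ \forall s\in\mathcal TY:\ \mu_{X\times Y}(\mathcal T\tau'_{X,Y}(\tau_{\mathcal TX,Y}(t,s)))=\mu_{X\times Y}(\mathcal T\tau_{X,Y}(\tau'_{X,\mathcal TY}(t,s)))\}$$ and let $\iota_X:\mathcal ZX\subseteq\mathcal TX$ be the inclusion. Then for every function $f:X\to Y$ the map $\mathcal Tf$ restricts to a function $\mathcal Zf:\mathcal ZX\to\mathcal ZY$; $\eta_X$, $\mu_X$ and $\tau_{X,Y}$ (co)restrict to functions $\eta^{\mathcal Z}_X:X\to\mathcal ZX$, $\mu^{\mathcal Z}_X:\mathcal Z\mathcal ZX\to\mathcal ZX$, $\tau^{\mathcal Z}_{X,Y}:X\times\mathcal ZY\to\mathcal Z(X\times Y)$; and $(\mathcal Z,\eta^{\mathcal Z},\mu^{\mathcal Z},\tau^{\mathcal Z})$ is a commutative strong monad on $\mathbf{Set}$ for which the inclusions $\iota_X$ form a monomorphism of strong monads $\iota:\mathcal Z\Rightarrow\mathcal T$ (so $\mathcal Z$ is a commutative submonad of $\mathcal T$). Moreover, the functor $\mathbf{Set}_{\mathcal Z}\to\mathbf{Set}_{\mathcal T}$ which is the identity on objects and sends $f:X\to\mathcal ZY$ to $\iota_Y\circ f$ corestricts to an isomorphism of categories $\mathbf{Set}_{\mathcal Z}\cong Z(\mathbf{Set}_{\mathcal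 T})$.
   Context: A strong monad $(\mathcal T,\eta,\mu,\tau)$ on a symmetric monoidal category $(\mathcal C,\otimes,I,\gamma)$ has left strength $\tau_{X,Y}:X\otimes\mathcal TY\to\mathcal T(X\otimes Y)$; its right strength is $\tau'_{X,Y}=\mathcal T(\gamma_{Y,X})\circ\tau_{Y,X}\circ\gamma_{\mathcal TX,Y}:\mathcal TX\otimes Y\to\mathcal T(X\otimes Y)$. It is commutative if $\mu_{X\otimes Y}\circ\mathcal T\tau'_{X,Y}\circ\tau_{\mathcal TX,Y}=\mu_{X\otimes Y}\circ\mathcal T\tau_{X,Y}\circ\tau'_{X,\mathcal TY}$ for all $X,Y$. A morphism of strong monads $\iota:\mathcal S\Rightarrow\mathcal T$ is a natural transformation with $\iota\circ\eta^{\mathcal S}=\eta^{\mathcal T}$, $\iota_X\circ\mu^{\mathcal S}_X=\mu^{\mathcal T}_X\circ\mathcal T\iota_X\circ\iota_{\mathcal SX}$ and $\iota_{X\otimes Y}\circ\tau^{\mathcal S}_{X,Y}=\tau^{\mathcal T}_{X,Y}\circ(X\otimes\iota_Y)$. The Kleisli category $\mathcal C_{\mathcal T}$ has the objects of $\mathcal C$, morphisms $X\to Y$ the morphisms $X\to\mathcal TY$ of $\mathcal C$, composition $g\odot f=\mu_Z\circ\mathcal Tg\circ f$, identities $\eta_X$. For $f:X\to\mathcal TY$ and an object $W$ set $f\otimes_l W=\tau'_{Y,W}\circ(f\otimes W)$ and $W\otimes_r f=\tau_{W,Y}\circ(W\otimes f)$. A Kleisli morphism $f:X\to\mathcal TY$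 is central if for every $f':X'\to\mathcal TY'$ one has $(Y\otimes_r f')\odot(f\otimes_l X')=(f\otimes_l Y')\odot(X\otimes_r f')$; the premonoidal centre $Z(\mathcal C_{\mathcal T})$ is the subcategory of $\mathcal C_{\mathcal T}$ with all objects and all central morphisms. *)

theory Defs
  imports "HOL-Library.FuncSet" "HOL-Library.Nat_Bijection"
begin

section \<open>Categories\<close>

text \<open>
  Objects are all elements of the type \<open>'o\<close>. The hom-sets need not be disjoint, so composition
  carries its three objects: \<open>Comp C X Y Z g f\<close> is the composite of \<open>f : X \<rightarrow> Y\<close> and \<open>g : Y \<rightarrow> Z\<close>.
  Likewise the action of a functor on \<open>f : X \<rightarrow> Y\<close> is \<open>Fm X Y f\<close>.
\<close>

record ('o, 'm) category =
  Hom :: "'o \<Rightarrow> 'o \<Rightarrow> 'm set"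
  Comp :: "'o \<Rightarrow> 'o \<Rightarrow> 'o \<Rightarrow> 'm \<Rightarrow> 'm \<Rightarrow> 'm"
  Ident :: "'o \<Rightarrow> 'm"

definition is_category :: "('o, 'm, 'z) category_scheme \<Rightarrow> bool" where
  "is_category C \<longleftrightarrow>
     (\<forall>X. Ident C X \<in> Hom C X X) \<and>
     (\<forall>X Y Z. \<forall>f \<in> Hom C X Y. \<forall>g \<in> Hom C Y Z. Comp C X Y Z g f \<in> Hom C X Z) \<and>
     (\<forall>X Y. \<forall>f \<in> Hom C X Y. Comp C X Y Y (Ident C Y) f = f \<and> Comp C X X Y f (Ident C X) = f) \<and>
     (\<forall>W X Y Z. \<forall>f \<in> Hom C W X. \<forall>g \<in> Hom C X Y. \<forall>h \<in> Hom C Y Z.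
        Comp C W Y Z h (Comp C W X Y g f) = Comp C W X Z (Comp C X Y Z h g) f)"

definition is_iso :: "('o, 'm, 'z) category_scheme \<Rightarrow> 'o \<Rightarrow> 'o \<Rightarrow> 'm \<Rightarrow> bool" where
  "is_iso C X Y f \<longleftrightarrow> f \<in> Hom C X Y \<and>
     (\<exists>g \<in> Hom C Y X. Comp C X Y X g f = Ident C X \<and> Comp C Y X Y f g = Ident C Y)"

definition is_mono :: "('o, 'm, 'z) category_scheme \<Rightarrow> 'o \<Rightarrow> 'o \<Rightarrow> 'm \<Rightarrow> bool" where
  "is_mono C X Y f \<longleftrightarrow> f \<in> Hom C X Y \<and>
     (\<forall>W. \<forall>g \<in> Hom C W X. \<forall>h \<in> Hom C W X. Comp C W X Y f g = Comp C W X Y f h \<longrightarrow> g = h)"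

definition is_functor ::
  "('o, 'm, 'z) category_scheme \<Rightarrow> ('p, 'n, 'y) category_scheme \<Rightarrow>
   ('o \<Rightarrow> 'p) \<Rightarrow> ('o \<Rightarrow> 'o \<Rightarrow> 'm \<Rightarrow> 'n) \<Rightarrow> bool" where
  "is_functor A B Fo Fm \<longleftrightarrow> is_category A \<and> is_category B \<and>
     (\<forall>X Y. \<forall>f \<in> Hom A X Y. Fm X Y f \<in> Hom B (Fo X) (Fo Y)) \<and>
     (\<forall>X. Fm X X (Ident A X) = Ident B (Fo X)) \<and>
     (\<forall>X Y Z. \<forall>f \<in> Hom A X Y. \<forall>g \<in> Hom A Y Z.
        Fm X Z (Comp A X Y Z g f) = Comp B (Fo X) (Fo Y) (Fo Z) (Fm Y Z g) (Fm X Y f))"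

definition is_category_isomorphism ::
  "('o, 'm, 'z) category_scheme \<Rightarrow> ('p, 'n, 'y) category_scheme \<Rightarrow>
   ('o \<Rightarrow> 'p) \<Rightarrow> ('o \<Rightarrow> 'o \<Rightarrow> 'm \<Rightarrow> 'n) \<Rightarrow> bool" where
  "is_category_isomorphism A B Fo Fm \<longleftrightarrow> is_functor A B Fo Fm \<and>
     (\<exists>Go Gm. is_functor B A Go Gm \<and>
        (\<forall>X. Go (Fo X) = X) \<and> (\<forall>X. Fo (Go X) = X) \<and>
        (\<forall>X Y. \<forall>f \<in> Hom A X Y. Gm (Fo X) (Fo Y) (Fm X Y f) = f) \<and>
        (\<forall>X Y. \<forall>g \<in> Hom B X Y. Fm (Go X) (Go Y) (Gm X Y g) = g))"

section \<open>Symmetric monoidal categories\<close>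

text \<open>
  For \<open>f : X \<rightarrow> X'\<close> and \<open>g : Y \<rightarrow> Y'\<close>, the morphism \<open>f \<otimes> g\<close> is \<open>TensMap C X X' Y Y' f g\<close>.
  The structure maps are
  \<open>Assoc C X Y Z : (X \<otimes> Y) \<otimes> Z \<rightarrow> X \<otimes> (Y \<otimes> Z)\<close>, \<open>LUnit C X : I \<otimes> X \<rightarrow> X\<close>,
  \<open>RUnit C X : X \<otimes> I \<rightarrow> X\<close> and \<open>Swap C X Y : X \<otimes> Y \<rightarrow> Y \<otimes> X\<close>.
\<close>

record ('o, 'm) monoidal_category = "('o, 'm) category" +
  Tens :: "'o \<Rightarrow> 'o \<Rightarrow> 'o"
  TensMap :: "'o \<Rightarrow> 'o \<Rightarrow> 'o \<Rightarrow> 'o \<Rightarrow> 'm \<Rightarrow> 'm \<Rightarrow> 'm"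
  Unit :: "'o"
  Assoc :: "'o \<Rightarrow> 'o \<Rightarrow> 'o \<Rightarrow> 'm"
  LUnit :: "'o \<Rightarrow> 'm"
  RUnit :: "'o \<Rightarrow> 'm"
  Swap :: "'o \<Rightarrow> 'o \<Rightarrow> 'm"

definition is_symmetric_monoidal :: "('o, 'm, 'z) monoidal_category_scheme \<Rightarrow> bool" where
  "is_symmetric_monoidal C \<longleftrightarrow> (let XX = Tens C; I = Unit C in
     is_category C \<and>
     \<comment> \<open>bifunctoriality\<close>
     (\<forall>X X' Y Y'. \<forall>f \<in> Hom C X X'. \<forall>g \<in> Hom C Y Y'.
        TensMap C X X' Y Y' f g \<in> Hom C (XX X Y) (XX X' Y')) \<and>
     (\<forall>X Y. TensMap C X X Y Y (Ident C X) (Ident C Y) = Ident C (XX X Y)) \<and>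
     (\<forall>X X' X'' Y Y' Y''. \<forall>f \<in> Hom C X X'. \<forall>f' \<in> Hom C X' X''. \<forall>g \<in> Hom C Y Y'. \<forall>g' \<in> Hom C Y' Y''.
        TensMap C X X'' Y Y'' (Comp C X X' X'' f' f) (Comp C Y Y' Y'' g' g) =
        Comp C (XX X Y) (XX X' Y') (XX X'' Y'')
          (TensMap C X' X'' Y' Y'' f' g') (TensMap C X X' Y Y' f g)) \<and>
     \<comment> \<open>structural isomorphisms and their naturality\<close>
     (\<forall>X Y Z. is_iso C (XX (XX X Y) Z) (XX X (XX Y Z)) (Assoc C X Y Z)) \<and>
     (\<forall>X. is_iso C (XX I X) X (LUnit C X)) \<and>
     (\<forall>X. is_iso C (XX X I) X (RUnit C X)) \<and>
     (\<forall>X Y. Swap C X Y \<in> Hom C (XX X Y) (XX Y X)) \<and>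
     (\<forall>X X' Y Y' Z Z'. \<forall>f \<in> Hom C X X'. \<forall>g \<in> Hom C Y Y'. \<forall>h \<in> Hom C Z Z'.
        Comp C (XX (XX X Y) Z) (XX (XX X' Y') Z') (XX X' (XX Y' Z')) (Assoc C X' Y' Z')
          (TensMap C (XX X Y) (XX X' Y') Z Z' (TensMap C X X' Y Y' f g) h) =
        Comp C (XX (XX X Y) Z) (XX X (XX Y Z)) (XX X' (XX Y' Z'))
          (TensMap C X X' (XX Y Z) (XX Y' Z') f (TensMap C Y Y' Z Z' g h)) (Assoc C X Y Z)) \<and>
     (\<forall>X X'. \<forall>f \<in> Hom C X X'.
        Comp C (XX I X) (XX I X') X' (LUnit C X') (TensMap C I I X X' (Ident C I) f) =
        Comp C (XX I X) X X' f (LUnit C X)) \<and>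
     (\<forall>X X'. \<forall>f \<in> Hom C X X'.
        Comp C (XX X I) (XX X' I) X' (RUnit C X') (TensMap C X X' I I f (Ident C I)) =
        Comp C (XX X I) X X' f (RUnit C X)) \<and>
     (\<forall>X X' Y Y'. \<forall>f \<in> Hom C X X'. \<forall>g \<in> Hom C Y Y'.
        Comp C (XX X Y) (XX X' Y') (XX Y' X') (Swap C X' Y') (TensMap C X X' Y Y' f g) =
        Comp C (XX X Y) (XX Y X) (XX Y' X') (TensMap C Y Y' X X' g f) (Swap C X Y)) \<and>
     \<comment> \<open>pentagon, triangle, symmetry, hexagon\<close>
     (\<forall>W X Y Z.
        Comp C (XX (XX (XX W X) Y) Z) (XX (XX W X) (XX Y Z)) (XX W (XX X (XX Y Z)))
          (Assoc C W X (XX Y Z)) (Assoc C (XX W X) Y Z) =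
        Comp C (XX (XX (XX W X) Y) Z) (XX W (XX (XX X Y) Z)) (XX W (XX X (XX Y Z)))
          (TensMap C W W (XX (XX X Y) Z) (XX X (XX Y Z)) (Ident C W) (Assoc C X Y Z))
          (Comp C (XX (XX (XX W X) Y) Z) (XX (XX W (XX X Y)) Z) (XX W (XX (XX X Y) Z))
            (Assoc C W (XX X Y) Z)
            (TensMap C (XX (XX W X) Y) (XX W (XX X Y)) Z Z (Assoc C W X Y) (Ident C Z)))) \<and>
     (\<forall>X Y.
        Comp C (XX (XX X I) Y) (XX X (XX I Y)) (XX X Y)
          (TensMap C X X (XX I Y) Y (Ident C X) (LUnit C Y)) (Assoc C X I Y) =
        TensMap C (XX X I) X Y Y (RUnit C X) (Ident C Y)) \<and>
     (\<forall>X Y. Comp C (XX X Y) (XX Y X) (XX X Y) (Swap C Y X) (Swap C X Y) = Ident C (XX X Y)) \<and>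
     (\<forall>X Y Z.
        Comp C (XX (XX X Y) Z) (XX (XX Y Z) X) (XX Y (XX Z X)) (Assoc C Y Z X)
          (Comp C (XX (XX X Y) Z) (XX X (XX Y Z)) (XX (XX Y Z) X) (Swap C X (XX Y Z)) (Assoc C X Y Z)) =
        Comp C (XX (XX X Y) Z) (XX Y (XX X Z)) (XX Y (XX Z X))
          (TensMap C Y Y (XX X Z) (XX Z X) (Ident C Y) (Swap C X Z))
          (Comp C (XX (XX X Y) Z) (XX (XX Y X) Z) (XX Y (XX X Z)) (Assoc C Y X Z)
            (TensMap C (XX X Y) (XX Y X) Z Z (Swap C X Y) (Ident C Z)))))"

section \<open>Strong monads\<close>

record ('o, 'm) monad_data =
  Tob :: "'o \<Rightarrow> 'o"
  Tmap :: "'o \<Rightarrow> 'o \<Rightarrow> 'm \<Rightarrow> 'm"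
  eta :: "'o \<Rightarrow> 'm"
  mu :: "'o \<Rightarrow> 'm"
  str :: "'o \<Rightarrow> 'o \<Rightarrow> 'm"

definition is_monad :: "('o, 'm, 'z) category_scheme \<Rightarrow> ('o, 'm, 'y) monad_data_scheme \<Rightarrow> bool" where
  "is_monad C T \<longleftrightarrow> (let F = Tob T in
     is_functor C C F (Tmap T) \<and>
     (\<forall>X. eta T X \<in> Hom C X (F X)) \<and>
     (\<forall>X. mu T X \<in> Hom C (F (F X)) (F X)) \<and>
     (\<forall>X Y. \<forall>f \<in> Hom C X Y.
        Comp C X Y (F Y) (eta T Y) f = Comp C X (F X) (F Y) (Tmap T X Y f) (eta T X)) \<and>
     (\<forall>X Y. \<forall>f \<in> Hom C X Y.
        Comp C (F (F X)) (F (F Y)) (F Y) (mu T Y) (Tmap T (F X) (F Y) (Tmap T X Y f)) =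
        Comp C (F (F X)) (F X) (F Y) (Tmap T X Y f) (mu T X)) \<and>
     (\<forall>X. Comp C (F X) (F (F X)) (F X) (mu T X) (eta T (F X)) = Ident C (F X)) \<and>
     (\<forall>X. Comp C (F X) (F (F X)) (F X) (mu T X) (Tmap T X (F X) (eta T X)) = Ident C (F X)) \<and>
     (\<forall>X. Comp C (F (F (F X))) (F (F X)) (F X) (mu T X) (mu T (F X)) =
          Comp C (F (F (F X))) (F (F X)) (F X) (mu T X) (Tmap T (F (F X)) (F X) (mu T X))))"

definition is_strong_monad ::
  "('o, 'm, 'z) monoidal_category_scheme \<Rightarrow> ('o, 'm, 'y) monad_data_scheme \<Rightarrow> bool" where
  "is_strong_monad C T \<longleftrightarrow> (let F = Tob T; XX = Tens C; I = Unit C in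
     is_monad C T \<and>
     (\<forall>X Y. str T X Y \<in> Hom C (XX X (F Y)) (F (XX X Y))) \<and>
     (\<forall>X X' Y Y'. \<forall>f \<in> Hom C X X'. \<forall>g \<in> Hom C Y Y'.
        Comp C (XX X (F Y)) (XX X' (F Y')) (F (XX X' Y')) (str T X' Y')
          (TensMap C X X' (F Y) (F Y') f (Tmap T Y Y' g)) =
        Comp C (XX X (F Y)) (F (XX X Y)) (F (XX X' Y'))
          (Tmap T (XX X Y) (XX X' Y') (TensMap C X X' Y Y' f g)) (str T X Y)) \<and>
     (\<forall>X. Comp C (XX I (F X)) (F (XX I X)) (F X) (Tmap T (XX I X) X (LUnit C X)) (str T I X) =
          LUnit C (F X)) \<and>
     (\<forall>X Y Z.
        Comp C (XX (XX X Y) (F Z)) (F (XX (XX X Y) Z)) (F (XX X (XX Y Z)))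
          (Tmap T (XX (XX X Y) Z) (XX X (XX Y Z)) (Assoc C X Y Z)) (str T (XX X Y) Z) =
        Comp C (XX (XX X Y) (F Z)) (XX X (F (XX Y Z))) (F (XX X (XX Y Z))) (str T X (XX Y Z))
          (Comp C (XX (XX X Y) (F Z)) (XX X (XX Y (F Z))) (XX X (F (XX Y Z)))
            (TensMap C X X (XX Y (F Z)) (F (XX Y Z)) (Ident C X) (str T Y Z)) (Assoc C X Y (F Z)))) \<and>
     (\<forall>X Y.
        Comp C (XX X Y) (XX X (F Y)) (F (XX X Y)) (str T X Y)
          (TensMap C X X Y (F Y) (Ident C X) (eta T Y)) = eta T (XX X Y)) \<and>
     (\<forall>X Y.
        Comp C (XX X (F (F Y))) (XX X (F Y)) (F (XX X Y)) (str T X Y)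
          (TensMap C X X (F (F Y)) (F Y) (Ident C X) (mu T Y)) =
        Comp C (XX X (F (F Y))) (F (F (XX X Y))) (F (XX X Y)) (mu T (XX X Y))
          (Comp C (XX X (F (F Y))) (F (XX X (F Y))) (F (F (XX X Y)))
            (Tmap T (XX X (F Y)) (F (XX X Y)) (str T X Y)) (str T X (F Y)))))"

definition rstr ::
  "('o, 'm, 'z) monoidal_category_scheme \<Rightarrow> ('o, 'm, 'y) monad_data_scheme \<Rightarrow> 'o \<Rightarrow> 'o \<Rightarrow> 'm" where
  "rstr C T X Y = (let F = Tob T; XX = Tens C in
     Comp C (XX (F X) Y) (F (XX Y X)) (F (XX X Y)) (Tmap T (XX Y X) (XX X Y) (Swap C Y X))
       (Comp C (XX (F X) Y) (XX Y (F X)) (F (XX Y X)) (str T Y X) (Swap C (F X) Y)))"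

definition is_commutative_monad ::
  "('o, 'm, 'z) monoidal_category_scheme \<Rightarrow> ('o, 'm, 'y) monad_data_scheme \<Rightarrow> bool" where
  "is_commutative_monad C T \<longleftrightarrow> (let F = Tob T; XX = Tens C in
     \<forall>X Y.
       Comp C (XX (F X) (F Y)) (F (F (XX X Y))) (F (XX X Y)) (mu T (XX X Y))
         (Comp C (XX (F X) (F Y)) (F (XX (F X) Y)) (F (F (XX X Y)))
           (Tmap T (XX (F X) Y) (F (XX X Y)) (rstr C T X Y)) (str T (F X) Y)) =
       Comp C (XX (F X) (F Y)) (F (F (XX X Y))) (F (XX X Y)) (mu T (XX X Y))
         (Comp C (XX (F X) (F Y)) (F (XX X (F Y))) (F (F (XX X Y)))
           (Tmap T (XX X (F Y)) (F (XX X Y)) (str T X Y)) (rstr C T X (F Y))))"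

definition is_strong_monad_morphism ::
  "('o, 'm, 'z) monoidal_category_scheme \<Rightarrow> ('o, 'm, 'y) monad_data_scheme \<Rightarrow>
   ('o, 'm, 'x) monad_data_scheme \<Rightarrow> ('o \<Rightarrow> 'm) \<Rightarrow> bool" where
  "is_strong_monad_morphism C S T i \<longleftrightarrow> (let G = Tob S; F = Tob T; XX = Tens C in
     (\<forall>X. i X \<in> Hom C (G X) (F X)) \<and>
     (\<forall>X Y. \<forall>f \<in> Hom C X Y.
        Comp C (G X) (G Y) (F Y) (i Y) (Tmap S X Y f) =
        Comp C (G X) (F X) (F Y) (Tmap T X Y f) (i X)) \<and>
     (\<forall>X. Comp C X (G X) (F X) (i X) (eta S X) = eta T X) \<and>
     (\<forall>X. Comp C (G (G X)) (G X) (F X) (i X) (mu S X) =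
          Comp C (G (G X)) (F (F X)) (F X) (mu T X)
            (Comp C (G (G X)) (F (G X)) (F (F X)) (Tmap T (G X) (F X) (i X)) (i (G X)))) \<and>
     (\<forall>X Y.
        Comp C (XX X (G Y)) (G (XX X Y)) (F (XX X Y)) (i (XX X Y)) (str S X Y) =
        Comp C (XX X (G Y)) (XX X (F Y)) (F (XX X Y)) (str T X Y)
          (TensMap C X X (G Y) (F Y) (Ident C X) (i Y))))"

text \<open>A monomorphism in the category of strong monads on \<open>C\<close> and their morphisms.\<close>

definition is_strong_monad_mono ::
  "('o, 'm, 'z) monoidal_category_scheme \<Rightarrow> ('o, 'm) monad_data \<Rightarrow> ('o, 'm) monad_data \<Rightarrow>
   ('o \<Rightarrow> 'm) \<Rightarrow> bool" where
  "is_strong_monad_mono C S T i \<longleftrightarrow> is_strong_monad_morphism C S T i \<and>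
     (\<forall>R :: ('o, 'm) monad_data. is_strong_monad C R \<longrightarrow>
        (\<forall>a b. is_strong_monad_morphism C R S a \<and> is_strong_monad_morphism C R S b \<and>
           (\<forall>X. Comp C (Tob R X) (Tob S X) (Tob T X) (i X) (a X) =
                Comp C (Tob R X) (Tob S X) (Tob T X) (i X) (b X)) \<longrightarrow> a = b))"

section \<open>Kleisli categories and the premonoidal centre\<close>

definition Kleisli ::
  "('o, 'm, 'z) category_scheme \<Rightarrow> ('o, 'm, 'y) monad_data_scheme \<Rightarrow> ('o, 'm) category" where
  "Kleisli C T =
     \<lparr> Hom = (\<lambda>X Y. Hom C X (Tob T Y)),
       Comp = (\<lambda>X Y Z g f.
         Comp C X (Tob T (Tob T Z)) (Tob T Z) (mu T Z)
           (Comp C X (Tob T Y) (Tob T (Tob T Z)) (Tmap T Y (Tob T Z) g) f)),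
       Ident = eta T \<rparr>"

text \<open>\<open>ltens C T X Y W f\<close> is \<open>f \<otimes>\<^sub>l W\<close> and \<open>rtens C T W X Y f\<close> is \<open>W \<otimes>\<^sub>r f\<close>, for \<open>f : X \<rightarrow> T Y\<close>.\<close>

definition ltens ::
  "('o, 'm, 'z) monoidal_category_scheme \<Rightarrow> ('o, 'm, 'y) monad_data_scheme \<Rightarrow>
   'o \<Rightarrow> 'o \<Rightarrow> 'o \<Rightarrow> 'm \<Rightarrow> 'm" where
  "ltens C T X Y W f =
     Comp C (Tens C X W) (Tens C (Tob T Y) W) (Tob T (Tens C Y W)) (rstr C T Y W)
       (TensMap C X (Tob T Y) W W f (Ident C W))"

definition rtens ::
  "('o, 'm, 'z) monoidal_category_scheme \<Rightarrow> ('o, 'm, 'y) monad_data_scheme \<Rightarrow>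
   'o \<Rightarrow> 'o \<Rightarrow> 'o \<Rightarrow> 'm \<Rightarrow> 'm" where
  "rtens C T W X Y f =
     Comp C (Tens C W X) (Tens C W (Tob T Y)) (Tob T (Tens C W Y)) (str T W Y)
       (TensMap C W W X (Tob T Y) (Ident C W) f)"

definition is_central ::
  "('o, 'm, 'z) monoidal_category_scheme \<Rightarrow> ('o, 'm, 'y) monad_data_scheme \<Rightarrow>
   'o \<Rightarrow> 'o \<Rightarrow> 'm \<Rightarrow> bool" where
  "is_central C T X Y f \<longleftrightarrow> (let XX = Tens C; K = Kleisli C T in
     \<forall>X' Y'. \<forall>f' \<in> Hom K X' Y'.
       Comp K (XX X X') (XX Y X') (XX Y Y') (rtens C T Y X' Y' f') (ltens C T X Y X' f) =
       Comp K (XX X X') (XX X Y') (XX Y Y') (ltens C T X Y Y' f) (rtens C T X X' Y' f'))"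

definition premonoidal_centre ::
  "('o, 'm, 'z) monoidal_category_scheme \<Rightarrow> ('o, 'm, 'y) monad_data_scheme \<Rightarrow> ('o, 'm) category" where
  "premonoidal_centre C T =
     (Kleisli C T) \<lparr> Hom := (\<lambda>X Y. {f \<in> Hom (Kleisli C T) X Y. is_central C T X Y f}) \<rparr>"

section \<open>The category of sets\<close>

text \<open>
  A universe of sets: the type \<open>'v\<close> is the class of all sets and \<open>E x\<close> is the class of elements of
  the set \<open>x\<close>. The axioms are those of second-order Zermelo-Fraenkel set theory without foundation
  and infinity, so every Grothendieck universe (and every type of ZF sets) is an instance.
\<close>

locale set_universe =
  fixes E :: "'v \<Rightarrow> 'v set"
  assumes extensionality: "E x = E y \<Longrightarrow> x = y"
    and separation: "A \<subseteq> E x \<Longrightarrow> \<exists>z. E z = A"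
    and pairing: "\<exists>z. E z = {x, y}"
    and union: "\<exists>z. E z = (\<Union>y \<in> E x. E y)"
    and power: "\<exists>z. E z = {y. E y \<subseteq> E x}"
    and replacement: "\<exists>z. E z = f ` E x"

text \<open>\<open>mk_set E A\<close> is the set with elements \<open>A\<close>; it is meaningful only if \<open>A\<close> is not a proper class.\<close>

definition mk_set :: "('v \<Rightarrow> 'v set) \<Rightarrow> 'v set \<Rightarrow> 'v" where
  "mk_set E A = (THE x. E x = A)"

definition pair :: "('v \<Rightarrow> 'v set) \<Rightarrow> 'v \<Rightarrow> 'v \<Rightarrow> 'v" where
  "pair E x y = mk_set E {mk_set E {x}, mk_set E {x, y}}"

definition pfst :: "('v \<Rightarrow> 'v set) \<Rightarrow> 'v \<Rightarrow> 'v" where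
  "pfst E p = (THE x. \<exists>y. p = pair E x y)"

definition psnd :: "('v \<Rightarrow> 'v set) \<Rightarrow> 'v \<Rightarrow> 'v" where
  "psnd E p = (THE y. \<exists>x. p = pair E x y)"

definition prod_set :: "('v \<Rightarrow> 'v set) \<Rightarrow> 'v \<Rightarrow> 'v \<Rightarrow> 'v" where
  "prod_set E X Y = mk_set E {pair E x y | x y. x \<in> E X \<and> y \<in> E Y}"

text \<open>
  Morphisms are extensional functions (\<open>undefined\<close> outside the elements of the domain), so that
  equality of morphisms with given domain and codomain is equality in HOL.
\<close>

definition Sets :: "('v \<Rightarrow> 'v set) \<Rightarrow> ('v, 'v \<Rightarrow> 'v) monoidal_category" where
  "Sets E =
     \<lparr> Hom = (\<lambda>X Y. E X \<rightarrow>\<^sub>E E Y),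
       Comp = (\<lambda>X Y Z g f. \<lambda>x\<in>E X. g (f x)),
       Ident = (\<lambda>X. \<lambda>x\<in>E X. x),
       Tens = prod_set E,
       TensMap = (\<lambda>X X' Y Y' f g. \<lambda>p\<in>E (prod_set E X Y). pair E (f (pfst E p)) (g (psnd E p))),
       Unit = mk_set E {mk_set E {}},
       Assoc = (\<lambda>X Y Z. \<lambda>p\<in>E (prod_set E (prod_set E X Y) Z).
         pair E (pfst E (pfst E p)) (pair E (psnd E (pfst E p)) (psnd E p))),
       LUnit = (\<lambda>X. \<lambda>p\<in>E (prod_set E (mk_set E {mk_set E {}}) X). psnd E p),
       RUnit = (\<lambda>X. \<lambda>p\<in>E (prod_set E X (mk_set E {mk_set E {}})). pfst E p),
       Swap = (\<lambda>X Y. \<lambda>p\<in>E (prod_set E X Y). pair E (psnd E p) (pfst E p)) \<rparr>"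

section \<open>The centre of a strong monad on sets\<close>

definition Zob :: "('v \<Rightarrow> 'v set) \<Rightarrow> ('v, 'v \<Rightarrow> 'v) monad_data \<Rightarrow> 'v \<Rightarrow> 'v" where
  "Zob E T X = mk_set E {t \<in> E (Tob T X). \<forall>Y. \<forall>s \<in> E (Tob T Y).
     mu T (prod_set E X Y)
       (Tmap T (prod_set E (Tob T X) Y) (Tob T (prod_set E X Y)) (rstr (Sets E) T X Y)
         (str T (Tob T X) Y (pair E t s))) =
     mu T (prod_set E X Y)
       (Tmap T (prod_set E X (Tob T Y)) (Tob T (prod_set E X Y)) (str T X Y)
         (rstr (Sets E) T X (Tob T Y) (pair E t s)))}"

definition Zincl :: "('v \<Rightarrow> 'v set) \<Rightarrow> ('v, 'v \<Rightarrow> 'v) monad_data \<Rightarrow> 'v \<Rightarrow> 'v \<Rightarrow> 'v" where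
  "Zincl E T X = (\<lambda>t\<in>E (Zob E T X). t)"

text \<open>
  An element of \<open>Z (Z X)\<close> lies in \<open>T (Z X)\<close>; it is carried to \<open>T (T X)\<close> by \<open>T\<close> applied to the
  inclusion before the multiplication of \<open>T\<close> is applied.
\<close>

definition Zmonad :: "('v \<Rightarrow> 'v set) \<Rightarrow> ('v, 'v \<Rightarrow> 'v) monad_data \<Rightarrow> ('v, 'v \<Rightarrow> 'v) monad_data" where
  "Zmonad E T =
     \<lparr> Tob = Zob E T,
       Tmap = (\<lambda>X Y f. \<lambda>t\<in>E (Zob E T X). Tmap T X Y f t),
       eta = eta T,
       mu = (\<lambda>X. \<lambda>w\<in>E (Zob E T (Zob E T X)). mu T X (Tmap T (Zob E T X) (Tob T X) (Zincl E T X) w)),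
       str = (\<lambda>X Y. \<lambda>p\<in>E (prod_set E X (Zob E T Y)). str T X Y p) \<rparr>"

section \<open>Basic facts\<close>

context set_universe
begin

lemma E_mk_set: "E z = A \<Longrightarrow> E (mk_set E A) = A"
  unfolding mk_set_def by (rule theI2[of "\<lambda>x. E x = A" z]) (auto intro: extensionality)

lemma E_mk_pair: "E (mk_set E {x, y}) = {x, y}"
  using pairing[of x y] E_mk_set by blast

lemma E_mk_single: "E (mk_set E {x}) = {x}"
  using E_mk_pair[of x x] by simp

lemma E_mk_empty: "E (mk_set E {}) = {}"
  using separation[of "{}"] E_mk_set by blast

lemma pair_eq_iff: "pair E a b = pair E c d \<longleftrightarrow> a = c \<and> b = d"
proof
  assume "pair E a b = pair E c d"
  then have "E (pair E a b) = E (pair E c d)" by simp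
  then have "{mk_set E {a}, mk_set E {a, b}} = {mk_set E {c}, mk_set E {c, d}}"
    by (simp add: pair_def E_mk_pair)
  then have "E ` {mk_set E {a}, mk_set E {a, b}} = E ` {mk_set E {c}, mk_set E {c, d}}" by simp
  then have "{{a}, {a, b}} = {{c}, {c, d}}" by (simp add: E_mk_pair E_mk_single)
  then show "a = c \<and> b = d" by (auto simp: doubleton_eq_iff)
qed simp

lemma pfst_pair: "pfst E (pair E x y) = x" and psnd_pair: "psnd E (pair E x y) = y"
  by (auto simp: pfst_def psnd_def pair_eq_iff)

lemma E_prod_set: "E (prod_set E X Y) = {pair E x y | x y. x \<in> E X \<and> y \<in> E Y}"
proof -
  have "\<forall>x. \<exists>z. E z = pair E x ` E Y" using replacement by blast
  then obtain r where r: "\<And>x. E (r x) = pair E x ` E Y" by metis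
  obtain w where w: "E w = r ` E X" using replacement by blast
  obtain z where "E z = (\<Union>y \<in> E w. E y)" using union by blast
  then have "E z = {pair E x y | x y. x \<in> E X \<and> y \<in> E Y}" by (auto simp: w r)
  then show ?thesis unfolding prod_set_def by (rule E_mk_set)
qed

lemma pair_in_prod: "pair E x y \<in> E (prod_set E X Y) \<longleftrightarrow> x \<in> E X \<and> y \<in> E Y"
  by (auto simp: E_prod_set pair_eq_iff)

lemma in_prodE:
  assumes "p \<in> E (prod_set E X Y)"
  obtains x y where "p = pair E x y" "x \<in> E X" "y \<in> E Y"
  using assms by (auto simp: E_prod_set)

lemma E_Zob: "E (Zob E T X) = {t \<in> E (Tob T X). \<forall>Y. \<forall>s \<in> E (Tob T Y).
     mu T (prod_set E X Y)
       (Tmap T (prod_set E (Tob T X) Y) (Tob T (prod_set E X Y)) (rstr (Sets E) T X Y)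
         (str T (Tob T X) Y (pair E t s))) =
     mu T (prod_set E X Y)
       (Tmap T (prod_set E X (Tob T Y)) (Tob T (prod_set E X Y)) (str T X Y)
         (rstr (Sets E) T X (Tob T Y) (pair E t s)))}" (is "_ = ?A")
proof -
  have "?A \<subseteq> E (Tob T X)" by blast
  then obtain z where "E z = ?A" using separation by blast
  then show ?thesis unfolding Zob_def by (rule E_mk_set)
qed

lemma is_category_Sets: "is_category (Sets E)"
  by (auto simp: is_category_def Sets_def PiE_iff extensional_def fun_eq_iff)

lemma Sets_simps:
  "Hom (Sets E) X Y = E X \<rightarrow>\<^sub>E E Y"
  "Comp (Sets E) X Y Z g f = (\<lambda>x\<in>E X. g (f x))"
  "Ident (Sets E) X = (\<lambda>x\<in>E X. x)"
  "Tens (Sets E) = prod_set E"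
  "TensMap (Sets E) X X' Y Y' f g =
     (\<lambda>p\<in>E (prod_set E X Y). pair E (f (pfst E p)) (g (psnd E p)))"
  "Unit (Sets E) = mk_set E {mk_set E {}}"
  "Assoc (Sets E) X Y Z = (\<lambda>p\<in>E (prod_set E (prod_set E X Y) Z).
     pair E (pfst E (pfst E p)) (pair E (psnd E (pfst E p)) (psnd E p)))"
  "LUnit (Sets E) X = (\<lambda>p\<in>E (prod_set E (mk_set E {mk_set E {}}) X). psnd E p)"
  "RUnit (Sets E) X = (\<lambda>p\<in>E (prod_set E X (mk_set E {mk_set E {}})). pfst E p)"
  "Swap (Sets E) X Y = (\<lambda>p\<in>E (prod_set E X Y). pair E (psnd E p) (pfst E p))"
  by (simp_all add: Sets_def)

lemma is_symmetric_monoidal_Sets: "is_symmetric_monoidal (Sets E)"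
proof -
  note s = Sets_simps pair_in_prod pfst_pair psnd_pair pair_eq_iff E_mk_single PiE_iff
  note t = pair_in_prod pfst_pair psnd_pair pair_eq_iff E_mk_single
  have 1: "is_iso (Sets E) (Tens (Sets E) (Tens (Sets E) X Y) Z) (Tens (Sets E) X (Tens (Sets E) Y Z))
     (Assoc (Sets E) X Y Z)" for X Y Z
    unfolding is_iso_def
    by (intro conjI bexI[where x = "\<lambda>p\<in>E (prod_set E X (prod_set E Y Z)).
         pair E (pair E (pfst E p) (pfst E (psnd E p))) (psnd E (psnd E p))"])
      (auto simp: s fun_eq_iff elim!: in_prodE)
  have 2: "is_iso (Sets E) (Tens (Sets E) (Unit (Sets E)) X) X (LUnit (Sets E) X)" for X
    unfolding is_iso_def
    by (intro conjI bexI[where x = "\<lambda>x\<in>E X. pair E (mk_set E {}) x"])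
      (auto simp: s fun_eq_iff elim!: in_prodE)
  have 3: "is_iso (Sets E) (Tens (Sets E) X (Unit (Sets E))) X (RUnit (Sets E) X)" for X
    unfolding is_iso_def
    by (intro conjI bexI[where x = "\<lambda>x\<in>E X. pair E x (mk_set E {})"])
      (auto simp: s fun_eq_iff elim!: in_prodE)
  show ?thesis
    unfolding is_symmetric_monoidal_def Let_def
    by (intro conjI allI ballI is_category_Sets 1 2 3; unfold Sets_simps;
        (rule restrict_ext | rule restrict_PiE_iff[THEN iffD2], rule ballI);
        elim in_prodE; simp add: t PiE_iff)
qed

end

text \<open>The axioms are satisfiable in HOL: the hereditarily finite sets, coded by natural numbers.\<close>

lemma set_universe_set_decode: "set_universe set_decode"
proof
  have fin: "\<exists>z. set_decode z = A" if "finite A" for A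
    using that set_encode_inverse by blast
  show "x = y" if "set_decode x = set_decode y" for x y
    using that by (metis set_decode_inverse)
  show "\<exists>z. set_decode z = A" if "A \<subseteq> set_decode x" for A x
    using that finite_set_decode finite_subset fin by blast
  show "\<exists>z. set_decode z = {x, y}" for x y
    by (rule fin) simp
  show "\<exists>z. set_decode z = (\<Union>y \<in> set_decode x. set_decode y)" for x
    by (rule fin) simp
  show "\<exists>z. set_decode z = {y. set_decode y \<subseteq> set_decode x}" for x
  proof (rule fin)
    have "{y. set_decode y \<subseteq> set_decode x} \<subseteq> set_encode ` Pow (set_decode x)"
    proof
      fix y assume "y \<in> {y. set_decode y \<subseteq> set_decode x}"
      then have "set_decode y \<in> Pow (set_decode x)" by blast
      then have "set_encode (set_decode y) \<in> set_encode ` Pow (set_decode x)" by (rule imageI)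
      then show "y \<in> set_encode ` Pow (set_decode x)" by (simp only: set_decode_inverse)
    qed
    then show "finite {y. set_decode y \<subseteq> set_decode x}"
      by (rule finite_subset) simp
  qed
  show "\<exists>z. set_decode z = f ` set_decode x" for f x
    by (rule fin) simp
qed

end

theory Submission
  imports Defs
begin

text \<open>
  Writing \<open>t \<bind> k\<close> for \<open>\<mu> (\<T> k t)\<close>, both the structure of \<open>\<T>\<close> and its strength are expressed by
  \<open>\<bind>\<close> and \<open>\<eta>\<close>, and \<open>t\<close> lies in the centre iff \<open>t \<bind> (\<lambda>x. s \<bind> k x) = s \<bind> (\<lambda>y. t \<bind> (\<lambda>x. k x y))\<close>
  for all \<open>s\<close> and \<open>k\<close>. This condition holds for \<open>\<eta> x\<close> and is preserved by \<open>\<bind>\<close>, so \<open>\<Z>\<close> is a monad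
  with the \<open>\<bind>\<close> of \<open>\<T>\<close>, commutative because its elements interchange with all those of \<open>\<T>\<close>. A Kleisli
  morphism is central iff its values are: test it against the identity of \<open>\<T> Y'\<close>, seen as a Kleisli
  morphism \<open>\<T> Y' \<rightarrow> Y'\<close>, at the points \<open>(x, s)\<close>.
\<close>

section \<open>Strong monads on sets from a bind operation\<close>

context set_universe
begin

text \<open>At elements, every axiom of a strong monad on sets follows from the unit and
  associativity laws of a Kleisli triple. Apart from \<open>bind_cong\<close>, the laws of
  \<open>b\<close> concern only elements of \<open>Tob S\<close>, so \<open>b\<close> may be the
  bind of a larger monad; \<open>Zmonad\<close> is obtained in this way from the bind of
  \<open>T\<close>.\<close>

lemma strong_monad_of_bind:
  fixes S :: "('v, 'v \<Rightarrow> 'v, 'z) monad_data_scheme"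
    and b :: "'v \<Rightarrow> 'v \<Rightarrow> ('v \<Rightarrow> 'v) \<Rightarrow> 'v \<Rightarrow> 'v"
  assumes eta: "\<And>X. eta S X \<in> E X \<rightarrow>\<^sub>E E (Tob S X)"
    and bind_in: "\<And>X Y k t. t \<in> E (Tob S X) \<Longrightarrow> (\<And>x. x \<in> E X \<Longrightarrow> k x \<in> E (Tob S Y))
      \<Longrightarrow> b X Y k t \<in> E (Tob S Y)"
    and bind_cong: "\<And>X Y k l t. (\<And>x. x \<in> E X \<Longrightarrow> k x = l x) \<Longrightarrow> b X Y k t = b X Y l t"
    and bind_eta: "\<And>X Y k x. x \<in> E X \<Longrightarrow> (\<And>x. x \<in> E X \<Longrightarrow> k x \<in> E (Tob S Y))
      \<Longrightarrow> b X Y k (eta S X x) = k x"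
    and eta_bind: "\<And>X t. t \<in> E (Tob S X) \<Longrightarrow> b X X (\<lambda>x. eta S X x) t = t"
    and bind_bind: "\<And>X Y Z k l t. t \<in> E (Tob S X) \<Longrightarrow> (\<And>x. x \<in> E X \<Longrightarrow> k x \<in> E (Tob S Y))
      \<Longrightarrow> (\<And>y. y \<in> E Y \<Longrightarrow> l y \<in> E (Tob S Z))
      \<Longrightarrow> b Y Z l (b X Y k t) = b X Z (\<lambda>x. b Y Z l (k x)) t"
    and Tmap: "\<And>X Y f. f \<in> E X \<rightarrow>\<^sub>E E Y
      \<Longrightarrow> Tmap S X Y f = (\<lambda>t\<in>E (Tob S X). b X Y (\<lambda>x. eta S Y (f x)) t)"
    and mu: "\<And>X. mu S X = (\<lambda>w\<in>E (Tob S (Tob S X)). b (Tob S X) X (\<lambda>t. t) w)"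
    and str: "\<And>X Y. str S X Y = (\<lambda>p\<in>E (prod_set E X (Tob S Y)).
      b Y (prod_set E X Y) (\<lambda>y. eta S (prod_set E X Y) (pair E (pfst E p) y)) (psnd E p))"
  shows "is_strong_monad (Sets E) S"
proof -
  note t = pair_in_prod pfst_pair psnd_pair pair_eq_iff E_mk_single
  have eta_in [simp]: "x \<in> E X \<Longrightarrow> eta S X x \<in> E (Tob S X)" for x X
    using eta[of X] by (auto simp: PiE_iff)
  have mem [simp]: "f \<in> E X \<rightarrow>\<^sub>E E Y \<Longrightarrow> x \<in> E X \<Longrightarrow> f x \<in> E Y" for f x X Y
    by (rule PiE_mem)
  have Tmap_hom: "f \<in> E X \<rightarrow>\<^sub>E E Y \<Longrightarrow> Tmap S X Y f \<in> E (Tob S X) \<rightarrow>\<^sub>E E (Tob S Y)" for X Y f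
    by (auto simp: Tmap intro!: bind_in)
  have mu_hom: "mu S X \<in> E (Tob S (Tob S X)) \<rightarrow>\<^sub>E E (Tob S X)" for X
    by (auto simp: mu intro!: bind_in)
  have str_hom: "str S X Y \<in> E (prod_set E X (Tob S Y)) \<rightarrow>\<^sub>E E (Tob S (prod_set E X Y))" for X Y
    by (auto simp: str t intro!: bind_in elim!: in_prodE)
  have Tmap_at: "f \<in> E X \<rightarrow>\<^sub>E E Y \<Longrightarrow> t \<in> E (Tob S X)
      \<Longrightarrow> Tmap S X Y f t = b X Y (\<lambda>x. eta S Y (f x)) t" for X Y f t
    by (simp add: Tmap)
  have mu_at: "w \<in> E (Tob S (Tob S X)) \<Longrightarrow> mu S X w = b (Tob S X) X (\<lambda>t. t) w" for X w
    by (simp add: mu)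
  have str_at: "x \<in> E X \<Longrightarrow> t \<in> E (Tob S Y)
      \<Longrightarrow> str S X Y (pair E x t) = b Y (prod_set E X Y) (\<lambda>y. eta S (prod_set E X Y) (pair E x y)) t"
    for X Y x t
    by (simp add: str t)
  have Tmap_bind: "Tmap S Y Z f (b X Y k t) = b X Z (\<lambda>x. Tmap S Y Z f (k x)) t"
    if "t \<in> E (Tob S X)" "\<And>x. x \<in> E X \<Longrightarrow> k x \<in> E (Tob S Y)" "f \<in> E Y \<rightarrow>\<^sub>E E Z" for X Y Z f k t
    using that by (auto simp: Tmap_at bind_in bind_bind intro!: bind_cong)
  have Tmap_eta: "Tmap S X Y f (eta S X x) = eta S Y (f x)"
    if "x \<in> E X" "f \<in> E X \<rightarrow>\<^sub>E E Y" for X Y f x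
    using that by (simp add: Tmap_at bind_eta)
  have bind_Tmap: "b Y Z l (Tmap S X Y f t) = b X Z (\<lambda>x. l (f x)) t"
    if "t \<in> E (Tob S X)" "f \<in> E X \<rightarrow>\<^sub>E E Y" "\<And>y. y \<in> E Y \<Longrightarrow> l y \<in> E (Tob S Z)" for X Y Z f l t
    using that by (auto simp: Tmap_at bind_bind bind_eta intro!: bind_cong)
  \<comment> \<open>Serves the typing of maps out of a product: after \<open>Pi_iff\<close>, the
    points of the product must be seen as pairs.\<close>
  have ball_prod: "(\<forall>p\<in>E (prod_set E X Y). P p) \<longleftrightarrow> (\<forall>x\<in>E X. \<forall>y\<in>E Y. P (pair E x y))" for X Y P
    by (auto simp: t elim!: in_prodE)
  have Tob_functor: "is_functor (Sets E) (Sets E) (Tob S) (Tmap S)"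
    unfolding is_functor_def Sets_simps
  proof (intro conjI allI ballI is_category_Sets)
    show "Tmap S X Y f \<in> E (Tob S X) \<rightarrow>\<^sub>E E (Tob S Y)" if "f \<in> E X \<rightarrow>\<^sub>E E Y" for X Y f
      using that by (rule Tmap_hom)
    show "Tmap S X X (\<lambda>x\<in>E X. x) = (\<lambda>x\<in>E (Tob S X). x)" for X
      \<comment> \<open>\<open>bind_cong\<close> removes the restriction of the identity, after
        which the right unit law applies.\<close>
      by (auto simp: Tmap intro!: restrict_ext trans[OF bind_cong eta_bind])
    show "Tmap S X Z (\<lambda>x\<in>E X. g (f x)) = (\<lambda>t\<in>E (Tob S X). Tmap S Y Z g (Tmap S X Y f t))"
      if "f \<in> E X \<rightarrow>\<^sub>E E Y" "g \<in> E Y \<rightarrow>\<^sub>E E Z" for X Y Z f g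
    proof -
      have gf: "(\<lambda>x\<in>E X. g (f x)) \<in> E X \<rightarrow>\<^sub>E E Z" using that by auto
      show ?thesis
        unfolding Tmap[OF gf]
      proof (rule restrict_ext)
        fix t assume "t \<in> E (Tob S X)"
        then show "b X Z (\<lambda>x. eta S Z ((\<lambda>x\<in>E X. g (f x)) x)) t = Tmap S Y Z g (Tmap S X Y f t)"
          using that by (auto simp: Tmap_at[of g] bind_Tmap PiE_mem[OF Tmap_hom] intro!: bind_cong)
      qed
    qed
  qed
  show ?thesis
    unfolding is_strong_monad_def is_monad_def Let_def
  \<comment> \<open>Most axioms equate two functions restricted to the same set, so they are
    compared at an element of it.\<close>
  proof (intro conjI allI ballI Tob_functor; unfold Sets_simps;
        (rule restrict_ext | rule eta mu_hom str_hom)?)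
    fix X
    show "eta S Y (f x) = Tmap S X Y f (eta S X x)" if "f \<in> E X \<rightarrow>\<^sub>E E Y" "x \<in> E X" for Y f x
      using that by (simp add: Tmap_eta)
    show "mu S Y (Tmap S (Tob S X) (Tob S Y) (Tmap S X Y f) w) = Tmap S X Y f (mu S X w)"
      if "f \<in> E X \<rightarrow>\<^sub>E E Y" "w \<in> E (Tob S (Tob S X))" for Y f w
      using that by (simp add: mu_at bind_Tmap Tmap_bind Tmap_hom PiE_mem[OF Tmap_hom])
    show "mu S X (eta S (Tob S X) t) = t" if "t \<in> E (Tob S X)" for t
      using that by (simp add: mu_at bind_eta)
    show "mu S X (Tmap S X (Tob S X) (eta S X) t) = t" if "t \<in> E (Tob S X)" for t
      using that by (simp add: mu_at bind_Tmap eta eta_bind PiE_mem[OF Tmap_hom])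
    show "mu S X (mu S (Tob S X) w) = mu S X (Tmap S (Tob S (Tob S X)) (Tob S X) (mu S X) w)"
      if "w \<in> E (Tob S (Tob S (Tob S X)))" for w
      using that by (auto simp: mu_at bind_Tmap bind_bind bind_in mu_hom PiE_mem[OF Tmap_hom] intro!: bind_cong)
    fix Y
    show "str S X' Y' ((\<lambda>p\<in>E (prod_set E X (Tob S Y)). pair E (f (pfst E p)) (Tmap S Y Y' g (psnd E p))) p)
        = Tmap S (prod_set E X Y) (prod_set E X' Y')
            (\<lambda>p\<in>E (prod_set E X Y). pair E (f (pfst E p)) (g (psnd E p))) (str S X Y p)"
      if "f \<in> E X \<rightarrow>\<^sub>E E X'" "g \<in> E Y \<rightarrow>\<^sub>E E Y'" "p \<in> E (prod_set E X (Tob S Y))" for X' Y' f g p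
      using that by (auto elim!: in_prodE intro!: bind_cong simp: t ball_prod Pi_iff str_at
          PiE_mem[OF Tmap_hom] bind_Tmap Tmap_bind Tmap_eta)
    show "Tmap S (prod_set E (mk_set E {mk_set E {}}) X) X
        (restrict (psnd E) (E (prod_set E (mk_set E {mk_set E {}}) X)))
        (str S (mk_set E {mk_set E {}}) X p) = psnd E p"
      if "p \<in> E (prod_set E (mk_set E {mk_set E {}}) (Tob S X))" for p
      using that by (auto elim!: in_prodE intro!: trans[OF bind_cong eta_bind] simp: t ball_prod Pi_iff str_at
          Tmap_bind Tmap_eta)
    show "str S X Y ((\<lambda>p\<in>E (prod_set E X (Tob S (Tob S Y))).
          pair E ((\<lambda>x\<in>E X. x) (pfst E p)) (mu S Y (psnd E p))) p)
        = mu S (prod_set E X Y) ((\<lambda>p\<in>E (prod_set E X (Tob S (Tob S Y))).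
            Tmap S (prod_set E X (Tob S Y)) (Tob S (prod_set E X Y)) (str S X Y) (str S X (Tob S Y) p)) p)"
      if "p \<in> E (prod_set E X (Tob S (Tob S Y)))" for p
      using that by (auto elim!: in_prodE intro!: bind_cong simp: t str_at str_hom mu_at bind_in
          bind_bind bind_eta Tmap_bind Tmap_eta PiE_mem[OF str_hom])
    show "(\<lambda>p\<in>E (prod_set E X Y). str S X Y ((\<lambda>p\<in>E (prod_set E X Y).
          pair E ((\<lambda>x\<in>E X. x) (pfst E p)) (eta S Y (psnd E p))) p)) = eta S (prod_set E X Y)"
      \<comment> \<open>Here \<open>eta\<close> is not written as a restriction; its extensionality
        comes from its typing.\<close>
      by (rule extensionalityI[of _ "E (prod_set E X Y)"])
        (auto elim!: in_prodE simp: t str_at bind_eta PiE_iff[THEN iffD1, OF eta])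
    fix Z
    show "Tmap S (prod_set E (prod_set E X Y) Z) (prod_set E X (prod_set E Y Z))
        (\<lambda>p\<in>E (prod_set E (prod_set E X Y) Z).
          pair E (pfst E (pfst E p)) (pair E (psnd E (pfst E p)) (psnd E p))) (str S (prod_set E X Y) Z p)
      = str S X (prod_set E Y Z) ((\<lambda>p\<in>E (prod_set E (prod_set E X Y) (Tob S Z)).
          (\<lambda>p\<in>E (prod_set E X (prod_set E Y (Tob S Z))).
            pair E ((\<lambda>x\<in>E X. x) (pfst E p)) (str S Y Z (psnd E p)))
          ((\<lambda>p\<in>E (prod_set E (prod_set E X Y) (Tob S Z)).
            pair E (pfst E (pfst E p)) (pair E (psnd E (pfst E p)) (psnd E p))) p)) p)"
      if "p \<in> E (prod_set E (prod_set E X Y) (Tob S Z))" for p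
      using that by (auto elim!: in_prodE intro!: bind_cong simp: t ball_prod Pi_iff str_at bind_in
          bind_bind bind_eta Tmap_bind Tmap_eta)
  qed
qed

end

section \<open>Elementwise laws of a strong monad on sets\<close>

lemma restrict_eq_at: "restrict f A = restrict g A \<Longrightarrow> a \<in> A \<Longrightarrow> f a = g a"
  by (metis restrict_apply')

text \<open>The locale is interpreted again at \<open>Zmonad E T\<close>, so that the facts on
  \<open>bind\<close>, interchange and Kleisli composition serve both monads.\<close>

locale strong_monad_on_sets = set_universe E for E :: "'v \<Rightarrow> 'v set" +
  fixes T :: "('v, 'v \<Rightarrow> 'v) monad_data"
  assumes strong: "is_strong_monad (Sets E) T"
begin

lemma eta_hom: "eta T X \<in> E X \<rightarrow>\<^sub>E E (Tob T X)"
  and mu_hom: "mu T X \<in> E (Tob T (Tob T X)) \<rightarrow>\<^sub>E E (Tob T X)"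
  and str_hom: "str T X Y \<in> E (prod_set E X (Tob T Y)) \<rightarrow>\<^sub>E E (Tob T (prod_set E X Y))"
  and Tmap_hom: "f \<in> E X \<rightarrow>\<^sub>E E Y \<Longrightarrow> Tmap T X Y f \<in> E (Tob T X) \<rightarrow>\<^sub>E E (Tob T Y)"
  and Tmap_id: "Tmap T X X (\<lambda>x\<in>E X. x) = (\<lambda>t\<in>E (Tob T X). t)"
  using strong unfolding is_strong_monad_def is_monad_def is_functor_def Let_def Sets_simps
  by (elim conjE; simp)+

lemma eta_in [simp]: "x \<in> E X \<Longrightarrow> eta T X x \<in> E (Tob T X)"
  and mu_in: "w \<in> E (Tob T (Tob T X)) \<Longrightarrow> mu T X w \<in> E (Tob T X)"
  and Tmap_in: "f \<in> E X \<rightarrow>\<^sub>E E Y \<Longrightarrow> t \<in> E (Tob T X) \<Longrightarrow> Tmap T X Y f t \<in> E (Tob T Y)"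
  and str_in: "x \<in> E X \<Longrightarrow> t \<in> E (Tob T Y) \<Longrightarrow> str T X Y (pair E x t) \<in> E (Tob T (prod_set E X Y))"
  by (simp_all add: PiE_mem[OF eta_hom] PiE_mem[OF mu_hom] PiE_mem[OF Tmap_hom]
      PiE_mem[OF str_hom] pair_in_prod)

text \<open>The axioms are kept exactly as unfolding produces them, as equations between functions;
  the lemmas that follow evaluate them at elements.\<close>

lemma strong_monad_laws:
  "\<forall>X Y Z. \<forall>f \<in> E X \<rightarrow>\<^sub>E E Y. \<forall>g \<in> E Y \<rightarrow>\<^sub>E E Z.
    Tmap T X Z (\<lambda>x\<in>E X. g (f x)) = (\<lambda>t\<in>E (Tob T X). Tmap T Y Z g (Tmap T X Y f t))"
  "\<forall>X Y. \<forall>f \<in> E X \<rightarrow>\<^sub>E E Y. (\<lambda>x\<in>E X. eta T Y (f x)) = (\<lambda>x\<in>E X. Tmap T X Y f (eta T X x))"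
  "\<forall>X Y. \<forall>f \<in> E X \<rightarrow>\<^sub>E E Y.
    (\<lambda>w\<in>E (Tob T (Tob T X)). mu T Y (Tmap T (Tob T X) (Tob T Y) (Tmap T X Y f) w)) =
    (\<lambda>w\<in>E (Tob T (Tob T X)). Tmap T X Y f (mu T X w))"
  "\<forall>X. (\<lambda>t\<in>E (Tob T X). mu T X (eta T (Tob T X) t)) = (\<lambda>t\<in>E (Tob T X). t)"
  "\<forall>X. (\<lambda>t\<in>E (Tob T X). mu T X (Tmap T X (Tob T X) (eta T X) t)) = (\<lambda>t\<in>E (Tob T X). t)"
  "\<forall>X. (\<lambda>w\<in>E (Tob T (Tob T (Tob T X))). mu T X (mu T (Tob T X) w)) =
    (\<lambda>w\<in>E (Tob T (Tob T (Tob T X))). mu T X (Tmap T (Tob T (Tob T X)) (Tob T X) (mu T X) w))"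
  "\<forall>X X' Y Y'. \<forall>f \<in> E X \<rightarrow>\<^sub>E E X'. \<forall>g \<in> E Y \<rightarrow>\<^sub>E E Y'.
    (\<lambda>p\<in>E (prod_set E X (Tob T Y)). str T X' Y' ((\<lambda>p\<in>E (prod_set E X (Tob T Y)).
      pair E (f (pfst E p)) (Tmap T Y Y' g (psnd E p))) p)) =
    (\<lambda>p\<in>E (prod_set E X (Tob T Y)). Tmap T (prod_set E X Y) (prod_set E X' Y')
      (\<lambda>p\<in>E (prod_set E X Y). pair E (f (pfst E p)) (g (psnd E p))) (str T X Y p))"
  "\<forall>X. (\<lambda>p\<in>E (prod_set E (mk_set E {mk_set E {}}) (Tob T X)).
      Tmap T (prod_set E (mk_set E {mk_set E {}}) X) X
        (\<lambda>p\<in>E (prod_set E (mk_set E {mk_set E {}}) X). psnd E p) (str T (mk_set E {mk_set E {}}) X p)) =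
    (\<lambda>p\<in>E (prod_set E (mk_set E {mk_set E {}}) (Tob T X)). psnd E p)"
  using strong unfolding is_strong_monad_def is_monad_def is_functor_def Let_def Sets_simps
  by - (elim conjE, assumption)+

lemma Tmap_Tmap:
  assumes f: "f \<in> E X \<rightarrow>\<^sub>E E Y" and g: "g \<in> E Y \<rightarrow>\<^sub>E E Z" and t: "t \<in> E (Tob T X)"
  shows "Tmap T Y Z g (Tmap T X Y f t) = Tmap T X Z (\<lambda>x\<in>E X. g (f x)) t"
proof -
  have "Tmap T X Z (\<lambda>x\<in>E X. g (f x)) = (\<lambda>t\<in>E (Tob T X). Tmap T Y Z g (Tmap T X Y f t))"
    using strong_monad_laws(1) f g by blast
  then show ?thesis using t by simp
qed

lemma Tmap_eta:
  assumes f: "f \<in> E X \<rightarrow>\<^sub>E E Y" and x: "x \<in> E X"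
  shows "Tmap T X Y f (eta T X x) = eta T Y (f x)"
proof -
  have "(\<lambda>x\<in>E X. eta T Y (f x)) = (\<lambda>x\<in>E X. Tmap T X Y f (eta T X x))"
    using strong_monad_laws(2) f by blast
  from restrict_eq_at[OF this x] show ?thesis by simp
qed

lemma mu_Tmap_Tmap:
  assumes f: "f \<in> E X \<rightarrow>\<^sub>E E Y" and w: "w \<in> E (Tob T (Tob T X))"
  shows "mu T Y (Tmap T (Tob T X) (Tob T Y) (Tmap T X Y f) w) = Tmap T X Y f (mu T X w)"
proof -
  have "(\<lambda>w\<in>E (Tob T (Tob T X)). mu T Y (Tmap T (Tob T X) (Tob T Y) (Tmap T X Y f) w)) =
      (\<lambda>w\<in>E (Tob T (Tob T X)). Tmap T X Y f (mu T X w))"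
    using strong_monad_laws(3) f by blast
  from restrict_eq_at[OF this w] show ?thesis .
qed

lemma mu_eta:
  assumes t: "t \<in> E (Tob T X)"
  shows "mu T X (eta T (Tob T X) t) = t"
proof -
  have "(\<lambda>t\<in>E (Tob T X). mu T X (eta T (Tob T X) t)) = (\<lambda>t\<in>E (Tob T X). t)"
    using strong_monad_laws(4) by blast
  from restrict_eq_at[OF this t] show ?thesis .
qed

lemma mu_Tmap_eta:
  assumes t: "t \<in> E (Tob T X)"
  shows "mu T X (Tmap T X (Tob T X) (eta T X) t) = t"
proof -
  have "(\<lambda>t\<in>E (Tob T X). mu T X (Tmap T X (Tob T X) (eta T X) t)) = (\<lambda>t\<in>E (Tob T X). t)"
    using strong_monad_laws(5) by blast
  from restrict_eq_at[OF this t] show ?thesis .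
qed

lemma mu_mu:
  assumes w: "w \<in> E (Tob T (Tob T (Tob T X)))"
  shows "mu T X (mu T (Tob T X) w) = mu T X (Tmap T (Tob T (Tob T X)) (Tob T X) (mu T X) w)"
proof -
  have "(\<lambda>w\<in>E (Tob T (Tob T (Tob T X))). mu T X (mu T (Tob T X) w)) =
      (\<lambda>w\<in>E (Tob T (Tob T (Tob T X))). mu T X (Tmap T (Tob T (Tob T X)) (Tob T X) (mu T X) w))"
    using strong_monad_laws(6) by blast
  from restrict_eq_at[OF this w] show ?thesis .
qed

text \<open>A strength on sets is unique: naturality along the point \<open>x : 1 \<rightarrow> X\<close> reduces it to the strength
  at \<open>1\<close>, which the unit law determines.\<close>

lemma str_eq_Tmap:
  assumes x: "x \<in> E X" and t: "t \<in> E (Tob T Y)"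
  shows "str T X Y (pair E x t) = Tmap T Y (prod_set E X Y) (\<lambda>y\<in>E Y. pair E x y) t"
proof -
  \<comment> \<open>\<open>I\<close> is the tensor unit with its only element \<open>c\<close>,
    \<open>f\<close> the point at \<open>x\<close>, \<open>l\<close> the left unitor of
    \<open>Y\<close>, \<open>m\<close> the tensor of \<open>f\<close> with the identity, and
    \<open>u\<close> the strength at the unit applied to \<open>t\<close>.\<close>
  define I where "I = mk_set E {mk_set E {}}"
  define c where "c = mk_set E {}"
  have I: "E I = {c}" by (simp add: I_def c_def E_mk_single)
  define f where "f = (\<lambda>_\<in>E I. x)"
  define l where "l = (\<lambda>p\<in>E (prod_set E I Y). psnd E p)"
  define m where "m = (\<lambda>p\<in>E (prod_set E I Y). pair E (f (pfst E p)) ((\<lambda>y\<in>E Y. y) (psnd E p)))"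
  define u where "u = str T I Y (pair E c t)"
  note s = pair_in_prod pfst_pair psnd_pair I
  have f: "f \<in> E I \<rightarrow>\<^sub>E E X" and i: "(\<lambda>y\<in>E Y. y) \<in> E Y \<rightarrow>\<^sub>E E Y" using x by (auto simp: f_def)
  have l: "l \<in> E (prod_set E I Y) \<rightarrow>\<^sub>E E Y" by (auto simp: l_def s elim!: in_prodE)
  have u: "u \<in> E (Tob T (prod_set E I Y))" using t by (simp add: u_def I str_in)
  have "(\<lambda>p\<in>E (prod_set E I (Tob T Y)). Tmap T (prod_set E I Y) Y l (str T I Y p)) =
      (\<lambda>p\<in>E (prod_set E I (Tob T Y)). psnd E p)"
    using strong_monad_laws(8) by (simp only: I_def l_def)
  from restrict_eq_at[OF this, of "pair E c t"] have lu: "Tmap T (prod_set E I Y) Y l u = t"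
    using t by (simp add: s u_def)
  have "(\<lambda>p\<in>E (prod_set E I (Tob T Y)). str T X Y ((\<lambda>p\<in>E (prod_set E I (Tob T Y)).
          pair E (f (pfst E p)) (Tmap T Y Y (\<lambda>y\<in>E Y. y) (psnd E p))) p)) =
      (\<lambda>p\<in>E (prod_set E I (Tob T Y)). Tmap T (prod_set E I Y) (prod_set E X Y) m (str T I Y p))"
    using strong_monad_laws(7) f i unfolding m_def by blast
  from restrict_eq_at[OF this, of "pair E c t"]
  have "str T X Y (pair E x t) = Tmap T (prod_set E I Y) (prod_set E X Y) m u"
    using t by (simp add: s u_def Tmap_id f_def)
  \<comment> \<open>As \<open>f\<close> is constant, \<open>m\<close> is the left unitor followed by
    pairing with \<open>x\<close>; functoriality splits off the action of \<open>l\<close>, which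
    sends \<open>u\<close> to \<open>t\<close> by \<open>lu\<close>.\<close>
  also have "m = (\<lambda>p\<in>E (prod_set E I Y). (\<lambda>y\<in>E Y. pair E x y) (l p))"
    by (auto simp: m_def l_def f_def s intro!: restrict_ext elim!: in_prodE)
  also have "Tmap T (prod_set E I Y) (prod_set E X Y) \<dots> u =
      Tmap T Y (prod_set E X Y) (\<lambda>y\<in>E Y. pair E x y) (Tmap T (prod_set E I Y) Y l u)"
    by (subst Tmap_Tmap[OF l _ u]) (auto simp: s x)
  finally show ?thesis by (simp add: lu)
qed

section \<open>The bind operation of \<open>T\<close>\<close>

definition bind :: "'v \<Rightarrow> 'v \<Rightarrow> ('v \<Rightarrow> 'v) \<Rightarrow> 'v \<Rightarrow> 'v" where
  "bind X Y k t = mu T Y (Tmap T X (Tob T Y) (restrict k (E X)) t)"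

text \<open>\<open>bind\<close> restricts its continuation before using it, so any function on the
  universe may serve as a continuation and only its values on \<open>E X\<close> count.\<close>

lemma bind_cong: "(\<And>x. x \<in> E X \<Longrightarrow> k x = l x) \<Longrightarrow> bind X Y k t = bind X Y l t"
  unfolding bind_def by (metis restrict_ext)

lemma bind_in: "t \<in> E (Tob T X) \<Longrightarrow> (\<And>x. x \<in> E X \<Longrightarrow> k x \<in> E (Tob T Y)) \<Longrightarrow> bind X Y k t \<in> E (Tob T Y)"
  unfolding bind_def by (intro mu_in Tmap_in) auto

lemma bind_eta: "x \<in> E X \<Longrightarrow> (\<And>x. x \<in> E X \<Longrightarrow> k x \<in> E (Tob T Y)) \<Longrightarrow> bind X Y k (eta T X x) = k x"
  unfolding bind_def by (subst Tmap_eta) (auto simp: mu_eta)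

lemma bind_eta_right: "t \<in> E (Tob T X) \<Longrightarrow> bind X X (\<lambda>x. eta T X x) t = t"
  using eta_hom[of X] unfolding bind_def by (simp add: mu_Tmap_eta)

lemma Tmap_eq_bind:
  assumes f: "f \<in> E X \<rightarrow>\<^sub>E E Y" and t: "t \<in> E (Tob T X)"
  shows "Tmap T X Y f t = bind X Y (\<lambda>x. eta T Y (f x)) t"
proof -
  have "bind X Y (\<lambda>x. eta T Y (f x)) t = mu T Y (Tmap T Y (Tob T Y) (eta T Y) (Tmap T X Y f t))"
    unfolding bind_def by (subst Tmap_Tmap[OF f eta_hom t]) simp
  then show ?thesis using f t by (simp add: mu_Tmap_eta Tmap_in)
qed

lemma bind_bind:
  assumes t: "t \<in> E (Tob T X)" and k: "\<And>x. x \<in> E X \<Longrightarrow> k x \<in> E (Tob T Y)"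
    and l: "\<And>y. y \<in> E Y \<Longrightarrow> l y \<in> E (Tob T Z)"
  shows "bind Y Z l (bind X Y k t) = bind X Z (\<lambda>x. bind Y Z l (k x)) t"
proof -
  define k' where "k' = restrict k (E X)"
  define l' where "l' = restrict l (E Y)"
  have k': "k' \<in> E X \<rightarrow>\<^sub>E E (Tob T Y)" and l': "l' \<in> E Y \<rightarrow>\<^sub>E E (Tob T Z)"
    using k l by (auto simp: k'_def l'_def)
  define Tl where "Tl = Tmap T Y (Tob T Z) l'"
  have Tl: "Tl \<in> E (Tob T Y) \<rightarrow>\<^sub>E E (Tob T (Tob T Z))" unfolding Tl_def by (rule Tmap_hom[OF l'])
  have Tk: "Tmap T X (Tob T Y) k' t \<in> E (Tob T (Tob T Y))" by (rule Tmap_in[OF k' t])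
  have Tlk: "(\<lambda>x\<in>E X. Tl (k' x)) \<in> E X \<rightarrow>\<^sub>E E (Tob T (Tob T Z))"
    using PiE_mem[OF Tl] PiE_mem[OF k'] by auto
  have "bind Y Z l (bind X Y k t) = mu T Z (Tl (mu T Y (Tmap T X (Tob T Y) k' t)))"
    by (simp add: bind_def k'_def l'_def Tl_def)
  \<comment> \<open>From here on: naturality of \<open>mu\<close> at \<open>l'\<close>,
    functoriality, associativity of \<open>mu\<close>, and functoriality again.\<close>
  also have "\<dots> = mu T Z (mu T (Tob T Z) (Tmap T (Tob T Y) (Tob T (Tob T Z)) Tl (Tmap T X (Tob T Y) k' t)))"
    unfolding Tl_def by (simp add: mu_Tmap_Tmap[OF l' Tk])
  also have "\<dots> = mu T Z (mu T (Tob T Z) (Tmap T X (Tob T (Tob T Z)) (\<lambda>x\<in>E X. Tl (k' x)) t))"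
    by (simp add: Tmap_Tmap[OF k' Tl t])
  also have "\<dots> = mu T Z (Tmap T (Tob T (Tob T Z)) (Tob T Z) (mu T Z)
      (Tmap T X (Tob T (Tob T Z)) (\<lambda>x\<in>E X. Tl (k' x)) t))"
    by (rule mu_mu[OF Tmap_in[OF Tlk t]])
  also have "\<dots> = mu T Z (Tmap T X (Tob T Z) (\<lambda>x\<in>E X. mu T Z ((\<lambda>x\<in>E X. Tl (k' x)) x)) t)"
    by (simp add: Tmap_Tmap[OF Tlk mu_hom t])
  also have "(\<lambda>x\<in>E X. mu T Z ((\<lambda>x\<in>E X. Tl (k' x)) x)) = restrict (\<lambda>x. bind Y Z l (k x)) (E X)"
    by (auto simp: bind_def Tl_def k'_def l'_def)
  finally show ?thesis unfolding bind_def[of X Z] .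
qed

lemma str_eq_bind:
  assumes "x \<in> E X" "t \<in> E (Tob T Y)"
  shows "str T X Y (pair E x t) =
    bind Y (prod_set E X Y) (\<lambda>y. eta T (prod_set E X Y) (pair E x y)) t"
proof -
  have "(\<lambda>y\<in>E Y. pair E x y) \<in> E Y \<rightarrow>\<^sub>E E (prod_set E X Y)"
    using assms by (simp add: pair_in_prod)
  then have "str T X Y (pair E x t) =
      bind Y (prod_set E X Y) (\<lambda>y. eta T (prod_set E X Y) ((\<lambda>y\<in>E Y. pair E x y) y)) t"
    using assms by (simp only: str_eq_Tmap Tmap_eq_bind)
  also have "\<dots> = bind Y (prod_set E X Y) (\<lambda>y. eta T (prod_set E X Y) (pair E x y)) t"
    by (rule bind_cong) simp
  finally show ?thesis .
qed

text \<open>The first swap in \<open>rstr\<close> puts \<open>y\<close> in front for the left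
  strength and the swap under \<open>Tmap\<close> restores the order, so only the side on which the
  constant stands differs from \<open>str_eq_bind\<close>.\<close>

lemma rstr_eq_bind:
  assumes "t \<in> E (Tob T X)" "y \<in> E Y"
  shows "rstr (Sets E) T X Y (pair E t y) =
    bind X (prod_set E X Y) (\<lambda>x. eta T (prod_set E X Y) (pair E x y)) t"
proof -
  note s = pair_in_prod pfst_pair psnd_pair
  have sw: "Swap (Sets E) Y X \<in> E (prod_set E Y X) \<rightarrow>\<^sub>E E (prod_set E X Y)"
    by (auto simp: Sets_simps s elim!: in_prodE)
  have sw_at: "Swap (Sets E) Y X (pair E y x) = pair E x y" if "x \<in> E X" for x
    using that assms by (simp add: Sets_simps s)
  have "rstr (Sets E) T X Y (pair E t y) =
      Tmap T (prod_set E Y X) (prod_set E X Y) (Swap (Sets E) Y X) (str T Y X (pair E y t))"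
    using assms by (simp add: rstr_def Let_def Sets_simps s)
  also have "\<dots> = bind (prod_set E Y X) (prod_set E X Y) (\<lambda>p. eta T (prod_set E X Y) (Swap (Sets E) Y X p))
      (bind X (prod_set E Y X) (\<lambda>x. eta T (prod_set E Y X) (pair E y x)) t)"
    using assms by (subst Tmap_eq_bind[OF sw str_in]) (simp_all add: str_eq_bind)
  also have "\<dots> = bind X (prod_set E X Y) (\<lambda>x. eta T (prod_set E X Y) (pair E x y)) t"
    using assms by (auto simp: bind_bind bind_eta s sw_at PiE_mem[OF sw] intro!: bind_cong)
  finally show ?thesis .
qed

lemma rstr_hom: "rstr (Sets E) T X Y \<in> E (prod_set E (Tob T X) Y) \<rightarrow>\<^sub>E E (Tob T (prod_set E X Y))"
proof -
  have "rstr (Sets E) T X Y \<in> extensional (E (prod_set E (Tob T X) Y))"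
    by (simp add: rstr_def Let_def Sets_simps)
  moreover have "rstr (Sets E) T X Y p \<in> E (Tob T (prod_set E X Y))"
    if "p \<in> E (prod_set E (Tob T X) Y)" for p
    using that by (rule in_prodE) (simp add: rstr_eq_bind bind_in pair_in_prod)
  ultimately show ?thesis by (simp add: PiE_iff)
qed

lemma mu_Tmap_eq_bind:
  assumes "f \<in> E X \<rightarrow>\<^sub>E E (Tob T Y)"
  shows "mu T Y (Tmap T X (Tob T Y) f t) = bind X Y f t"
  using assms by (simp add: bind_def)

text \<open>Starting with the left strength binds \<open>s\<close> on the outside; the composite in
  the next lemma starts with the right strength and binds \<open>t\<close> on the outside. The
  centre condition compares these two orders.\<close>

lemma mu_Tmap_rstr_str:
  assumes "t \<in> E (Tob T X)" "s \<in> E (Tob T Y)"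
  shows "mu T (prod_set E X Y) (Tmap T (prod_set E (Tob T X) Y) (Tob T (prod_set E X Y))
      (rstr (Sets E) T X Y) (str T (Tob T X) Y (pair E t s))) =
    bind Y (prod_set E X Y) (\<lambda>y. bind X (prod_set E X Y) (\<lambda>x. eta T (prod_set E X Y) (pair E x y)) t) s"
  using assms by (auto simp: mu_Tmap_eq_bind rstr_hom str_eq_bind bind_bind pair_in_prod
      PiE_mem[OF rstr_hom] bind_eta rstr_eq_bind intro!: bind_cong)

lemma mu_Tmap_str_rstr:
  assumes "t \<in> E (Tob T X)" "s \<in> E (Tob T Y)"
  shows "mu T (prod_set E X Y) (Tmap T (prod_set E X (Tob T Y)) (Tob T (prod_set E X Y))
      (str T X Y) (rstr (Sets E) T X (Tob T Y) (pair E t s))) =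
    bind X (prod_set E X Y) (\<lambda>x. bind Y (prod_set E X Y) (\<lambda>y. eta T (prod_set E X Y) (pair E x y)) s) t"
  using assms by (auto simp: mu_Tmap_eq_bind str_hom str_eq_bind bind_bind pair_in_prod
      PiE_mem[OF str_hom] bind_eta rstr_eq_bind intro!: bind_cong)

section \<open>Interchange and closure properties of the centre\<close>

definition interchange :: "'v \<Rightarrow> 'v \<Rightarrow> 'v \<Rightarrow> 'v \<Rightarrow> bool" where
  "interchange X Y t s \<longleftrightarrow>
    bind Y (prod_set E X Y) (\<lambda>y. bind X (prod_set E X Y) (\<lambda>x. eta T (prod_set E X Y) (pair E x y)) t) s =
    bind X (prod_set E X Y) (\<lambda>x. bind Y (prod_set E X Y) (\<lambda>y. eta T (prod_set E X Y) (pair E x y)) s) t"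

text \<open>\<open>interchange\<close> speaks only of the pairing as continuation. A continuation in
  two variables factors through the product, so binding both sides of that equation along
  \<open>?k\<close> gives the general case by associativity.\<close>

lemma interchange_bind:
  assumes "interchange X Y t s" and t: "t \<in> E (Tob T X)" and s: "s \<in> E (Tob T Y)"
    and k: "\<And>x y. x \<in> E X \<Longrightarrow> y \<in> E Y \<Longrightarrow> k x y \<in> E (Tob T W)"
  shows "bind Y W (\<lambda>y. bind X W (\<lambda>x. k x y) t) s = bind X W (\<lambda>x. bind Y W (k x) s) t"
proof -
  let ?P = "prod_set E X Y"
  let ?k = "\<lambda>p. k (pfst E p) (psnd E p)"
  have k': "p \<in> E ?P \<Longrightarrow> ?k p \<in> E (Tob T W)" for p
    using k by (auto simp: pfst_pair psnd_pair elim!: in_prodE)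
  have "bind ?P W ?k (bind Y ?P (\<lambda>y. bind X ?P (\<lambda>x. eta T ?P (pair E x y)) t) s) =
      bind Y W (\<lambda>y. bind X W (\<lambda>x. k x y) t) s"
    using t s k by (auto simp: bind_bind k' bind_in pair_in_prod bind_eta pfst_pair psnd_pair intro!: bind_cong)
  moreover have "bind ?P W ?k (bind X ?P (\<lambda>x. bind Y ?P (\<lambda>y. eta T ?P (pair E x y)) s) t) =
      bind X W (\<lambda>x. bind Y W (k x) s) t"
    using t s k by (auto simp: bind_bind k' bind_in pair_in_prod bind_eta pfst_pair psnd_pair intro!: bind_cong)
  ultimately show ?thesis using assms(1) by (simp add: interchange_def)
qed

text \<open>Evaluation at pairs turns the two composites into the two nested binds. This is used at
  the second interpretation, to prove \<open>Zmonad E T\<close> commutative.\<close>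

lemma is_commutative_monad_iff:
  "is_commutative_monad (Sets E) T \<longleftrightarrow>
    (\<forall>X Y. \<forall>t \<in> E (Tob T X). \<forall>s \<in> E (Tob T Y). interchange X Y t s)"
proof -
  have ext_prod: "(restrict f (E (prod_set E A B)) = restrict g (E (prod_set E A B))) \<longleftrightarrow>
      (\<forall>a \<in> E A. \<forall>b \<in> E B. f (pair E a b) = g (pair E a b))" for f g A B
    by (auto simp: pair_in_prod intro!: restrict_ext elim!: in_prodE) (metis pair_in_prod restrict_eq_at)
  show ?thesis
    unfolding is_commutative_monad_def Let_def Sets_simps(2,4) ext_prod
    by (simp add: pair_in_prod mu_Tmap_rstr_str mu_Tmap_str_rstr interchange_def)
qed

lemma in_Zob_iff:
  "t \<in> E (Zob E T X) \<longleftrightarrow> t \<in> E (Tob T X) \<and> (\<forall>Y. \<forall>s \<in> E (Tob T Y). interchange X Y t s)"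
  by (auto simp: E_Zob mu_Tmap_rstr_str mu_Tmap_str_rstr interchange_def)

lemma Zob_subset: "t \<in> E (Zob E T X) \<Longrightarrow> t \<in> E (Tob T X)"
  by (simp add: in_Zob_iff)

text \<open>By the left unit law both orders collapse to a single bind of \<open>s\<close> that
  pairs with \<open>x\<close>.\<close>

lemma eta_in_Zob: "x \<in> E X \<Longrightarrow> eta T X x \<in> E (Zob E T X)"
  by (auto simp: in_Zob_iff interchange_def bind_eta bind_in pair_in_prod intro!: bind_cong)

text \<open>The test element \<open>s\<close> is carried past the central \<open>t\<close> and then
  past each central \<open>k x\<close>, with associativity at both ends. In the first move the
  continuation runs \<open>k x\<close> instead of pairing, which is why
  \<open>interchange_bind\<close> is needed.\<close>

lemma bind_in_Zob:
  assumes t: "t \<in> E (Zob E T X)" and k: "\<And>x. x \<in> E X \<Longrightarrow> k x \<in> E (Zob E T Y)"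
  shows "bind X Y k t \<in> E (Zob E T Y)"
  unfolding in_Zob_iff
proof (intro conjI allI ballI)
  note tT = Zob_subset[OF t] and kT = Zob_subset[OF k]
  show "bind X Y k t \<in> E (Tob T Y)" using tT kT by (rule bind_in)
  fix W s assume s: "s \<in> E (Tob T W)"
  let ?P = "prod_set E Y W"
  have in1: "bind Y ?P (\<lambda>y. eta T ?P (pair E y w)) (k x) \<in> E (Tob T ?P)" if "x \<in> E X" "w \<in> E W" for x w
    using that kT by (auto simp: pair_in_prod intro!: bind_in)
  have in2: "bind W ?P (\<lambda>w. eta T ?P (pair E y w)) s \<in> E (Tob T ?P)" if "y \<in> E Y" for y
    using that s by (auto simp: pair_in_prod intro!: bind_in)
  have "bind W ?P (\<lambda>w. bind Y ?P (\<lambda>y. eta T ?P (pair E y w)) (bind X Y k t)) s =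
      bind W ?P (\<lambda>w. bind X ?P (\<lambda>x. bind Y ?P (\<lambda>y. eta T ?P (pair E y w)) (k x)) t) s"
    using tT kT by (intro bind_cong bind_bind) (auto simp: pair_in_prod)
  also have "\<dots> = bind X ?P (\<lambda>x. bind W ?P (\<lambda>w. bind Y ?P (\<lambda>y. eta T ?P (pair E y w)) (k x)) s) t"
    using t s in1 by (intro interchange_bind) (auto simp: in_Zob_iff)
  also have "\<dots> = bind X ?P (\<lambda>x. bind Y ?P (\<lambda>y. bind W ?P (\<lambda>w. eta T ?P (pair E y w)) s) (k x)) t"
    using k s by (intro bind_cong interchange_bind) (auto simp: in_Zob_iff pair_in_prod)
  also have "\<dots> = bind Y ?P (\<lambda>y. bind W ?P (\<lambda>w. eta T ?P (pair E y w)) s) (bind X Y k t)"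
    using tT kT in2 by (simp add: bind_bind)
  finally show "interchange Y W (bind X Y k t) s" by (simp add: interchange_def)
qed

text \<open>The functor action and, in the next lemma, the strength are binds of a central element
  along values of \<open>eta\<close>, so closure under \<open>bind\<close> covers both.\<close>

lemma Tmap_in_Zob:
  assumes "f \<in> E X \<rightarrow>\<^sub>E E Y" "t \<in> E (Zob E T X)"
  shows "Tmap T X Y f t \<in> E (Zob E T Y)"
  using assms by (auto simp: Tmap_eq_bind Zob_subset intro!: bind_in_Zob eta_in_Zob)

lemma str_in_Zob:
  assumes "x \<in> E X" "t \<in> E (Zob E T Y)"
  shows "str T X Y (pair E x t) \<in> E (Zob E T (prod_set E X Y))"
  using assms by (auto simp: str_eq_bind Zob_subset pair_in_prod intro!: bind_in_Zob eta_in_Zob)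

section \<open>The commutative strong monad of central elements\<close>

lemma mu_Tmap_Zincl: "mu T X (Tmap T (Zob E T X) (Tob T X) (Zincl E T X) w) = bind (Zob E T X) X (\<lambda>t. t) w"
  by (simp add: bind_def Zincl_def)

text \<open>\<open>Zincl\<close> is the restricted identity, so the multiplication of
  \<open>Zmonad\<close> is a bind of \<open>T\<close> with the identity as continuation.\<close>

lemma Zmonad_simps:
  "Tob (Zmonad E T) = Zob E T"
  "Tmap (Zmonad E T) X Y f = (\<lambda>t\<in>E (Zob E T X). Tmap T X Y f t)"
  "eta (Zmonad E T) = eta T"
  "mu (Zmonad E T) X = (\<lambda>w\<in>E (Zob E T (Zob E T X)). bind (Zob E T X) X (\<lambda>t. t) w)"
  "str (Zmonad E T) X Y = (\<lambda>p\<in>E (prod_set E X (Zob E T Y)). str T X Y p)"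
  by (simp_all add: Zmonad_def mu_Tmap_Zincl)

text \<open>The equations are those of \<open>T\<close> restricted to central elements; what the
  centre adds is closure under \<open>eta\<close> and \<open>bind\<close>.\<close>

lemma is_strong_monad_Zmonad: "is_strong_monad (Sets E) (Zmonad E T)"
proof (rule strong_monad_of_bind[where b = bind]; (unfold Zmonad_simps)?)
  show "eta T X \<in> E X \<rightarrow>\<^sub>E E (Zob E T X)" for X
    using eta_hom[of X] eta_in_Zob by (auto simp: PiE_iff)
  show "(\<lambda>t\<in>E (Zob E T X). Tmap T X Y f t) = (\<lambda>t\<in>E (Zob E T X). bind X Y (\<lambda>x. eta T Y (f x)) t)"
    if "f \<in> E X \<rightarrow>\<^sub>E E Y" for X Y f
    using that by (auto simp: Tmap_eq_bind Zob_subset)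
  show "(\<lambda>p\<in>E (prod_set E X (Zob E T Y)). str T X Y p) = (\<lambda>p\<in>E (prod_set E X (Zob E T Y)).
      bind Y (prod_set E X Y) (\<lambda>y. eta T (prod_set E X Y) (pair E (pfst E p) y)) (psnd E p))" for X Y
    by (auto simp: str_eq_bind Zob_subset pfst_pair psnd_pair intro!: restrict_ext elim!: in_prodE)
qed (auto intro: bind_in_Zob bind_cong bind_eta bind_eta_right bind_bind Zob_subset)

text \<open>Transfers interchange and Kleisli composition from \<open>T\<close> to
  \<open>Zmonad E T\<close>.\<close>

lemma Z_bind_eq:
  assumes t: "t \<in> E (Zob E T X)" and k: "\<And>x. x \<in> E X \<Longrightarrow> k x \<in> E (Zob E T Y)"
  shows "strong_monad_on_sets.bind E (Zmonad E T) X Y k t = bind X Y k t"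
proof -
  interpret Z: strong_monad_on_sets E "Zmonad E T"
    by unfold_locales (rule is_strong_monad_Zmonad)
  have k': "restrict k (E X) \<in> E X \<rightarrow>\<^sub>E E (Zob E T Y)" using k by auto
  \<comment> \<open>The bind of \<open>Zmonad\<close> passes through the object
    \<open>Zob E T Y\<close> where that of \<open>T\<close> passes through \<open>Tob T Y\<close>;
    associativity and the left unit law eliminate the intermediate object.\<close>
  have "Z.bind X Y k t = bind (Zob E T Y) Y (\<lambda>t. t) (Tmap T X (Zob E T Y) (restrict k (E X)) t)"
    using t Tmap_in_Zob[OF k' t] by (simp add: Z.bind_def Zmonad_simps)
  also have "\<dots> = bind X Y k t"
    using t k by (auto simp: Tmap_eq_bind[OF k'] Zob_subset bind_bind bind_eta eta_in_Zob intro!: bind_cong)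
  finally show ?thesis .
qed

text \<open>Once the binds are those of \<open>T\<close>, the equation is an instance of the
  condition that makes \<open>t\<close> central, since \<open>s\<close> is in particular an element
  of \<open>Tob T Y\<close>.\<close>

lemma is_commutative_monad_Zmonad: "is_commutative_monad (Sets E) (Zmonad E T)"
proof -
  interpret Z: strong_monad_on_sets E "Zmonad E T"
    by unfold_locales (rule is_strong_monad_Zmonad)
  have "Z.interchange X Y t s" if t: "t \<in> E (Zob E T X)" and s: "s \<in> E (Zob E T Y)" for X Y t s
  proof -
    let ?P = "prod_set E X Y"
    have "Z.bind Y ?P (\<lambda>y. Z.bind X ?P (\<lambda>x. eta T ?P (pair E x y)) t) s =
        bind Y ?P (\<lambda>y. bind X ?P (\<lambda>x. eta T ?P (pair E x y)) t) s"
      \<comment> \<open>The outer bind is replaced first; \<open>bind_cong\<close> then supplies the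
        membership under which the inner one can be replaced.\<close>
      using t s by (subst Z_bind_eq)
        (auto simp: Z_bind_eq eta_in_Zob bind_in_Zob pair_in_prod intro!: bind_cong)
    moreover have "Z.bind X ?P (\<lambda>x. Z.bind Y ?P (\<lambda>y. eta T ?P (pair E x y)) s) t =
        bind X ?P (\<lambda>x. bind Y ?P (\<lambda>y. eta T ?P (pair E x y)) s) t"
      using t s by (subst Z_bind_eq)
        (auto simp: Z_bind_eq eta_in_Zob bind_in_Zob pair_in_prod intro!: bind_cong)
    moreover have "interchange X Y t s" using t s by (simp add: in_Zob_iff)
    ultimately show ?thesis by (simp add: Z.interchange_def interchange_def Zmonad_simps)
  qed
  then show ?thesis by (simp add: Z.is_commutative_monad_iff Zmonad_simps)
qed

section \<open>The inclusion as a monomorphism of strong monads\<close>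

lemma Zincl_hom: "Zincl E T X \<in> E (Zob E T X) \<rightarrow>\<^sub>E E (Tob T X)"
  by (auto simp: Zincl_def Zob_subset)

text \<open>Morphisms do not record their codomain, so composing with an inclusion leaves the
  function unchanged. Hence the comparison functor acts as the identity on functions.\<close>

lemma Comp_Zincl: "f \<in> E X \<rightarrow>\<^sub>E E (Zob E T Y)
  \<Longrightarrow> Comp (Sets E) X (Zob E T Y) (Tob T Y) (Zincl E T Y) f = f"
  by (rule extensionalityI[of _ "E X"]) (auto simp: Sets_simps Zincl_def PiE_iff)

lemma is_strong_monad_morphism_Zincl: "is_strong_monad_morphism (Sets E) (Zmonad E T) T (Zincl E T)"
  unfolding is_strong_monad_morphism_def Let_def Zmonad_simps Sets_simps
proof (intro conjI allI ballI Zincl_hom; (rule restrict_ext)?)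
  fix X
  show "Zincl E T Y ((\<lambda>t\<in>E (Zob E T X). Tmap T X Y f t) t) = Tmap T X Y f (Zincl E T X t)"
    if "f \<in> E X \<rightarrow>\<^sub>E E Y" "t \<in> E (Zob E T X)" for Y f t
    using that by (simp add: Zincl_def Tmap_in_Zob)
  show "(\<lambda>x\<in>E X. Zincl E T X (eta T X x)) = eta T X"
    using eta_hom[of X] by (intro extensionalityI[of _ "E X"]) (auto simp: Zincl_def eta_in_Zob PiE_iff)
  show "Zincl E T X ((\<lambda>w\<in>E (Zob E T (Zob E T X)). bind (Zob E T X) X (\<lambda>t. t) w) w) =
      mu T X ((\<lambda>w\<in>E (Zob E T (Zob E T X)).
        Tmap T (Zob E T X) (Tob T X) (Zincl E T X) (Zincl E T (Zob E T X) w)) w)"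
    if "w \<in> E (Zob E T (Zob E T X))" for w
    \<comment> \<open>Only the inclusion at \<open>Zob E T X\<close> is unfolded at first: the one
      at \<open>X\<close> must stay folded for \<open>mu_Tmap_Zincl\<close> to match.\<close>
    using that by (simp add: mu_Tmap_Zincl Zincl_def[of _ _ "Zob E T X"])
      (simp add: Zincl_def bind_in_Zob)
  show "Zincl E T (prod_set E X Y) ((\<lambda>p\<in>E (prod_set E X (Zob E T Y)). str T X Y p) p) =
      str T X Y ((\<lambda>p\<in>E (prod_set E X (Zob E T Y)).
        pair E ((\<lambda>x\<in>E X. x) (pfst E p)) (Zincl E T Y (psnd E p))) p)"
    if "p \<in> E (prod_set E X (Zob E T Y))" for Y p
    using that by (auto simp: Zincl_def str_in_Zob pair_in_prod pfst_pair psnd_pair elim!: in_prodE)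
qed

lemma is_mono_Zincl: "is_mono (Sets E) (Zob E T X) (Tob T X) (Zincl E T X)"
  unfolding is_mono_def
proof (intro conjI allI ballI impI)
  show "Zincl E T X \<in> Hom (Sets E) (Zob E T X) (Tob T X)" by (simp add: Sets_simps Zincl_hom)
  show "g = h" if "g \<in> Hom (Sets E) W (Zob E T X)" "h \<in> Hom (Sets E) W (Zob E T X)"
    "Comp (Sets E) W (Zob E T X) (Tob T X) (Zincl E T X) g =
     Comp (Sets E) W (Zob E T X) (Tob T X) (Zincl E T X) h" for W g h
    using that by (simp add: Comp_Zincl Sets_simps(1))
qed

text \<open>Monomorphy is checked componentwise: morphisms of strong monads are families of
  functions, and each component of \<open>Zincl\<close> is monic in sets.\<close>

lemma is_strong_monad_mono_Zincl: "is_strong_monad_mono (Sets E) (Zmonad E T) T (Zincl E T)"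
  unfolding is_strong_monad_mono_def
proof (intro conjI allI impI is_strong_monad_morphism_Zincl ext)
  fix R :: "('v, 'v \<Rightarrow> 'v) monad_data" and a b X
  assume ab: "is_strong_monad_morphism (Sets E) R (Zmonad E T) a \<and>
    is_strong_monad_morphism (Sets E) R (Zmonad E T) b \<and>
    (\<forall>X. Comp (Sets E) (Tob R X) (Tob (Zmonad E T) X) (Tob T X) (Zincl E T X) (a X) =
         Comp (Sets E) (Tob R X) (Tob (Zmonad E T) X) (Tob T X) (Zincl E T X) (b X))"
  then have "a X \<in> Hom (Sets E) (Tob R X) (Zob E T X)" "b X \<in> Hom (Sets E) (Tob R X) (Zob E T X)"
    by (simp_all add: is_strong_monad_morphism_def Let_def Zmonad_simps)
  then have "a X = b X"
    using ab is_mono_Zincl[of X] unfolding is_mono_def Zmonad_simps by blast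
  then show "a X v = b X v" for v by simp
qed

section \<open>The Kleisli category of \<open>T\<close>\<close>

lemma Hom_Kleisli: "Hom (Kleisli (Sets E) T) X Y = E X \<rightarrow>\<^sub>E E (Tob T Y)"
  by (simp add: Kleisli_def Sets_simps)

lemma Ident_Kleisli: "Ident (Kleisli (Sets E) T) = eta T"
  by (simp add: Kleisli_def)

lemma Comp_Kleisli:
  "g \<in> E Y \<rightarrow>\<^sub>E E (Tob T Z) \<Longrightarrow> Comp (Kleisli (Sets E) T) X Y Z g f = (\<lambda>x\<in>E X. bind Y Z g (f x))"
  by (auto simp: Kleisli_def Sets_simps(2) mu_Tmap_eq_bind)

lemma Comp_Kleisli_hom: "f \<in> E X \<rightarrow>\<^sub>E E (Tob T Y) \<Longrightarrow> g \<in> E Y \<rightarrow>\<^sub>E E (Tob T Z)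
    \<Longrightarrow> Comp (Kleisli (Sets E) T) X Y Z g f \<in> E X \<rightarrow>\<^sub>E E (Tob T Z)"
  by (auto simp: Comp_Kleisli PiE_mem[of f] PiE_mem[of g] intro!: bind_in)

lemma is_category_Kleisli: "is_category (Kleisli (Sets E) T)"
  unfolding is_category_def Hom_Kleisli Ident_Kleisli
proof (intro conjI allI ballI)
  show "eta T X \<in> E X \<rightarrow>\<^sub>E E (Tob T X)" for X by (rule eta_hom)
  fix W X Y Z f g h
  assume g: "g \<in> E X \<rightarrow>\<^sub>E E (Tob T Y)"
  note gm = PiE_mem[OF g]
  show "Comp (Kleisli (Sets E) T) X Y Y (eta T Y) g = g"
    by (rule extensionalityI[of _ "E X"])
      (use g gm in \<open>auto simp: Comp_Kleisli[OF eta_hom] bind_eta_right PiE_iff\<close>)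
  show "Comp (Kleisli (Sets E) T) X X Y g (eta T X) = g"
    by (rule extensionalityI[of _ "E X"])
      (use g gm in \<open>auto simp: Comp_Kleisli[OF g] bind_eta PiE_iff\<close>)
  assume h: "h \<in> E Y \<rightarrow>\<^sub>E E (Tob T Z)"
  note hm = PiE_mem[OF h]
  show "Comp (Kleisli (Sets E) T) X Y Z h g \<in> E X \<rightarrow>\<^sub>E E (Tob T Z)"
    using g h by (rule Comp_Kleisli_hom)
  assume f: "f \<in> E W \<rightarrow>\<^sub>E E (Tob T X)"
  show "Comp (Kleisli (Sets E) T) W Y Z h (Comp (Kleisli (Sets E) T) W X Y g f) =
      Comp (Kleisli (Sets E) T) W X Z (Comp (Kleisli (Sets E) T) X Y Z h g) f"
    \<comment> \<open>The left factor is itself a composite, and its typing must be supplied before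
      the composition can be unfolded.\<close>
    unfolding Comp_Kleisli[OF Comp_Kleisli_hom[OF g h]]
    by (auto simp: Comp_Kleisli g h gm hm PiE_mem[OF f] bind_bind intro!: restrict_ext bind_cong)
qed

section \<open>Premonoidal structure and central morphisms\<close>

lemma
  assumes "f \<in> E X \<rightarrow>\<^sub>E E (Tob T Y)"
  shows rtens_hom: "rtens (Sets E) T W X Y f \<in> E (prod_set E W X) \<rightarrow>\<^sub>E E (Tob T (prod_set E W Y))"
    and ltens_hom: "ltens (Sets E) T X Y W f \<in> E (prod_set E X W) \<rightarrow>\<^sub>E E (Tob T (prod_set E Y W))"
proof -
  have f: "x \<in> E X \<Longrightarrow> f x \<in> E (Tob T Y)" for x using assms by (rule PiE_mem)
  show "rtens (Sets E) T W X Y f \<in> E (prod_set E W X) \<rightarrow>\<^sub>E E (Tob T (prod_set E W Y))"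
    "ltens (Sets E) T X Y W f \<in> E (prod_set E X W) \<rightarrow>\<^sub>E E (Tob T (prod_set E Y W))"
    by (auto simp: rtens_def ltens_def Sets_simps pair_in_prod pfst_pair psnd_pair f str_in
        PiE_mem[OF rstr_hom] elim!: in_prodE)
qed

lemma rtens_apply: "w \<in> E W \<Longrightarrow> x \<in> E X
    \<Longrightarrow> rtens (Sets E) T W X Y f (pair E w x) = str T W Y (pair E w (f x))"
  and ltens_apply: "w \<in> E W \<Longrightarrow> x \<in> E X
    \<Longrightarrow> ltens (Sets E) T X Y W f (pair E x w) = rstr (Sets E) T Y W (pair E (f x) w)"
  by (simp_all add: rtens_def ltens_def Sets_simps pair_in_prod pfst_pair psnd_pair)

text \<open>At \<open>pair E x x'\<close> the two composites are the two nested binds of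
  \<open>f x\<close> and \<open>f' x'\<close>: in \<open>lr\<close> the value of \<open>f\<close> is
  bound on the outside, in \<open>rl\<close> that of \<open>f'\<close>.\<close>

lemma is_central_iff:
  assumes f: "f \<in> E X \<rightarrow>\<^sub>E E (Tob T Y)"
  shows "is_central (Sets E) T X Y f \<longleftrightarrow> (\<forall>x \<in> E X. f x \<in> E (Zob E T Y))"
proof -
  note fm = PiE_mem[OF f]
  have lr: "Comp (Kleisli (Sets E) T) (prod_set E X X') (prod_set E Y X') (prod_set E Y Y')
        (rtens (Sets E) T Y X' Y' f') (ltens (Sets E) T X Y X' f) (pair E x x') =
      bind Y (prod_set E Y Y') (\<lambda>y. bind Y' (prod_set E Y Y')
        (\<lambda>y'. eta T (prod_set E Y Y') (pair E y y')) (f' x')) (f x)"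
    and rl: "Comp (Kleisli (Sets E) T) (prod_set E X X') (prod_set E X Y') (prod_set E Y Y')
        (ltens (Sets E) T X Y Y' f) (rtens (Sets E) T X X' Y' f') (pair E x x') =
      bind Y' (prod_set E Y Y') (\<lambda>y'. bind Y (prod_set E Y Y')
        (\<lambda>y. eta T (prod_set E Y Y') (pair E y y')) (f x)) (f' x')"
    if f': "f' \<in> E X' \<rightarrow>\<^sub>E E (Tob T Y')" and x: "x \<in> E X" "x' \<in> E X'" for X' Y' f' x x'
    using x fm PiE_mem[OF f']
    by (auto simp: Comp_Kleisli rtens_hom[OF f'] ltens_hom[OF f] pair_in_prod rtens_apply ltens_apply
        rstr_eq_bind str_eq_bind bind_bind bind_eta bind_in PiE_mem[OF rtens_hom[OF f']]
        PiE_mem[OF ltens_hom[OF f]] intro!: bind_cong)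
  show ?thesis
  proof
    assume c: "is_central (Sets E) T X Y f"
    show "\<forall>x \<in> E X. f x \<in> E (Zob E T Y)"
      unfolding in_Zob_iff
    proof (intro ballI conjI allI)
      fix x assume x: "x \<in> E X"
      show "f x \<in> E (Tob T Y)" using x by (rule fm)
      fix Y' s assume s: "s \<in> E (Tob T Y')"
      \<comment> \<open>The domain of \<open>j\<close> is \<open>Tob T Y'\<close>, so every
        \<open>s\<close> is available as a point and is its own value under
        \<open>j\<close>.\<close>
      define j where "j = (\<lambda>s\<in>E (Tob T Y'). s)"
      have j: "j \<in> E (Tob T Y') \<rightarrow>\<^sub>E E (Tob T Y')" by (simp add: j_def)
      have "Comp (Kleisli (Sets E) T) (prod_set E X (Tob T Y')) (prod_set E Y (Tob T Y')) (prod_set E Y Y')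
          (rtens (Sets E) T Y (Tob T Y') Y' j) (ltens (Sets E) T X Y (Tob T Y') f) =
        Comp (Kleisli (Sets E) T) (prod_set E X (Tob T Y')) (prod_set E X Y') (prod_set E Y Y')
          (ltens (Sets E) T X Y Y' f) (rtens (Sets E) T X (Tob T Y') Y' j)"
        using c j unfolding is_central_def Let_def Sets_simps(4) Hom_Kleisli by blast
      from fun_cong[OF this, of "pair E x s"] show "interchange Y Y' (f x) s"
        using lr[OF j x s] rl[OF j x s] s by (simp add: interchange_def j_def)
    qed
  next
    assume z: "\<forall>x \<in> E X. f x \<in> E (Zob E T Y)"
    show "is_central (Sets E) T X Y f"
      unfolding is_central_def Let_def Sets_simps(4) Hom_Kleisli
    proof (intro allI ballI)
      fix X' Y' f' assume f': "f' \<in> E X' \<rightarrow>\<^sub>E E (Tob T Y')"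
      show "Comp (Kleisli (Sets E) T) (prod_set E X X') (prod_set E Y X') (prod_set E Y Y')
          (rtens (Sets E) T Y X' Y' f') (ltens (Sets E) T X Y X' f) =
        Comp (Kleisli (Sets E) T) (prod_set E X X') (prod_set E X Y') (prod_set E Y Y')
          (ltens (Sets E) T X Y Y' f) (rtens (Sets E) T X X' Y' f')" (is "?l = ?r")
      proof (rule extensionalityI)
        show "?l \<in> extensional (E (prod_set E X X'))" "?r \<in> extensional (E (prod_set E X X'))"
          using ltens_hom[OF f] rtens_hom[OF f'] by (simp_all add: Comp_Kleisli)
        fix p assume "p \<in> E (prod_set E X X')"
        then obtain x x' where p: "p = pair E x x'" "x \<in> E X" "x' \<in> E X'" by (rule in_prodE)
        \<comment> \<open>\<open>f' x'\<close> is an element of \<open>Tob T Y'\<close>, hence one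
          of those with which the central \<open>f x\<close> interchanges.\<close>
        then have "interchange Y Y' (f x) (f' x')"
          using z PiE_mem[OF f'] by (simp add: in_Zob_iff)
        then show "?l p = ?r p"
          using lr[OF f' p(2,3)] rl[OF f' p(2,3)] by (simp add: interchange_def p(1))
      qed
    qed
  qed
qed

text \<open>By \<open>is_central_iff\<close>, and because hom-sets consist of plain functions, this
  is an equality of sets and not just a bijection. The isomorphism of categories rests on
  it.\<close>

lemma Hom_premonoidal_centre: "Hom (premonoidal_centre (Sets E) T) X Y = E X \<rightarrow>\<^sub>E E (Zob E T Y)"
proof (rule set_eqI)
  fix f
  have "f \<in> E X \<rightarrow>\<^sub>E E (Zob E T Y) \<Longrightarrow> f \<in> E X \<rightarrow>\<^sub>E E (Tob T Y)"
    by (auto simp: PiE_iff Zob_subset)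
  moreover have "f \<in> E X \<rightarrow>\<^sub>E E (Zob E T Y) \<longleftrightarrow> is_central (Sets E) T X Y f"
    if f: "f \<in> E X \<rightarrow>\<^sub>E E (Tob T Y)"
    using f unfolding is_central_iff[OF f] by (simp add: PiE_iff)
  moreover have "f \<in> Hom (premonoidal_centre (Sets E) T) X Y \<longleftrightarrow>
      f \<in> E X \<rightarrow>\<^sub>E E (Tob T Y) \<and> is_central (Sets E) T X Y f"
    by (simp add: premonoidal_centre_def Hom_Kleisli)
  ultimately show "f \<in> Hom (premonoidal_centre (Sets E) T) X Y \<longleftrightarrow> f \<in> E X \<rightarrow>\<^sub>E E (Zob E T Y)"
    by blast
qed

section \<open>The isomorphism with the premonoidal centre\<close>

lemma Comp_premonoidal_centre:
    "Comp (premonoidal_centre (Sets E) T) = Comp (Kleisli (Sets E) T)"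
  and Ident_premonoidal_centre: "Ident (premonoidal_centre (Sets E) T) = eta T"
  by (simp_all add: premonoidal_centre_def Ident_Kleisli)

lemma Hom_Kleisli_Zmonad: "Hom (Kleisli (Sets E) (Zmonad E T)) X Y = E X \<rightarrow>\<^sub>E E (Zob E T Y)"
  and Ident_Kleisli_Zmonad: "Ident (Kleisli (Sets E) (Zmonad E T)) = eta T"
  by (simp_all add: Kleisli_def Sets_simps Zmonad_simps)

lemma Zob_hom_subset: "f \<in> E X \<rightarrow>\<^sub>E E (Zob E T Y) \<Longrightarrow> f \<in> E X \<rightarrow>\<^sub>E E (Tob T Y)"
  by (auto simp: PiE_iff Zob_subset)

text \<open>Both composites are given at each point by a bind, and \<open>Z_bind_eq\<close>
  identifies the two.\<close>

lemma Comp_Kleisli_Zmonad: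
  assumes f: "f \<in> E X \<rightarrow>\<^sub>E E (Zob E T Y)" and g: "g \<in> E Y \<rightarrow>\<^sub>E E (Zob E T Z)"
  shows "Comp (Kleisli (Sets E) (Zmonad E T)) X Y Z g f = Comp (Kleisli (Sets E) T) X Y Z g f"
proof -
  interpret Z: strong_monad_on_sets E "Zmonad E T"
    by unfold_locales (rule is_strong_monad_Zmonad)
  have g': "g \<in> E Y \<rightarrow>\<^sub>E E (Tob (Zmonad E T) Z)" using g by (simp add: Zmonad_simps)
  show ?thesis
    unfolding Z.Comp_Kleisli[OF g'] Comp_Kleisli[OF Zob_hom_subset[OF g]]
    using PiE_mem[OF f] PiE_mem[OF g] by (intro restrict_ext) (simp add: Z_bind_eq)
qed

lemma Comp_Kleisli_in_Zob:
  assumes f: "f \<in> E X \<rightarrow>\<^sub>E E (Zob E T Y)" and g: "g \<in> E Y \<rightarrow>\<^sub>E E (Zob E T Z)"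
  shows "Comp (Kleisli (Sets E) T) X Y Z g f \<in> E X \<rightarrow>\<^sub>E E (Zob E T Z)"
  using PiE_mem[OF f] PiE_mem[OF g] by (simp add: Comp_Kleisli[OF Zob_hom_subset[OF g]] bind_in_Zob)

lemma is_category_Kleisli_Zmonad: "is_category (Kleisli (Sets E) (Zmonad E T))"
proof -
  interpret Z: strong_monad_on_sets E "Zmonad E T"
    by unfold_locales (rule is_strong_monad_Zmonad)
  show ?thesis by (rule Z.is_category_Kleisli)
qed

lemma eta_hom_Zob: "eta T X \<in> E X \<rightarrow>\<^sub>E E (Zob E T X)"
  using eta_hom[of X] by (simp add: PiE_iff eta_in_Zob)

text \<open>The equations are inherited from the Kleisli category; centrality of identities and
  composites is \<open>eta_hom_Zob\<close> and \<open>Comp_Kleisli_in_Zob\<close>.\<close>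

lemma is_category_premonoidal_centre: "is_category (premonoidal_centre (Sets E) T)"
  using is_category_Kleisli
  unfolding is_category_def Hom_premonoidal_centre Comp_premonoidal_centre Ident_premonoidal_centre
    Hom_Kleisli Ident_Kleisli
  by (simp add: eta_hom_Zob Comp_Kleisli_in_Zob Zob_hom_subset)

lemma is_functor_Zincl_Kleisli:
  "is_functor (Kleisli (Sets E) (Zmonad E T)) (Kleisli (Sets E) T)
    (\<lambda>X. X) (\<lambda>X Y f. Comp (Sets E) X (Zob E T Y) (Tob T Y) (Zincl E T Y) f)"
  unfolding is_functor_def Hom_Kleisli_Zmonad Ident_Kleisli_Zmonad Hom_Kleisli Ident_Kleisli
  by (simp add: is_category_Kleisli is_category_Kleisli_Zmonad Comp_Zincl Zob_hom_subset eta_hom_Zob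
      Comp_Kleisli_Zmonad Comp_Kleisli_in_Zob)

lemma is_category_isomorphism_Zincl:
  "is_category_isomorphism (Kleisli (Sets E) (Zmonad E T)) (premonoidal_centre (Sets E) T)
    (\<lambda>X. X) (\<lambda>X Y f. Comp (Sets E) X (Zob E T Y) (Tob T Y) (Zincl E T Y) f)"
  unfolding is_category_isomorphism_def
\<comment> \<open>The inverse is the identity on objects and on functions, as both categories have
  the same hom-sets and identities and the same composition on them.\<close>
proof (intro conjI exI[of _ "\<lambda>X. X"] exI[of _ "\<lambda>X Y f. f"])
  show "is_functor (Kleisli (Sets E) (Zmonad E T)) (premonoidal_centre (Sets E) T)
    (\<lambda>X. X) (\<lambda>X Y f. Comp (Sets E) X (Zob E T Y) (Tob T Y) (Zincl E T Y) f)"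
    and "is_functor (premonoidal_centre (Sets E) T) (Kleisli (Sets E) (Zmonad E T)) (\<lambda>X. X) (\<lambda>X Y f. f)"
    unfolding is_functor_def Hom_Kleisli_Zmonad Ident_Kleisli_Zmonad Hom_premonoidal_centre
      Ident_premonoidal_centre Comp_premonoidal_centre
    by (simp_all add: is_category_premonoidal_centre is_category_Kleisli_Zmonad Comp_Zincl eta_hom_Zob
        Comp_Kleisli_Zmonad Comp_Kleisli_in_Zob)
qed (simp_all add: Hom_Kleisli_Zmonad Hom_premonoidal_centre Comp_Zincl)

end

theorem mainTheorem1:
  fixes E :: "'v \<Rightarrow> 'v set" and T :: "('v, 'v \<Rightarrow> 'v) monad_data"
  assumes "set_universe E" and "is_strong_monad (Sets E) T"
  shows
    "(\<forall>X Y. \<forall>f \<in> Hom (Sets E) X Y. \<forall>t \<in> E (Zob E T X). Tmap T X Y f t \<in> E (Zob E T Y)) \<and>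
     (\<forall>X. \<forall>x \<in> E X. eta T X x \<in> E (Zob E T X)) \<and>
     (\<forall>X. \<forall>w \<in> E (Zob E T (Zob E T X)).
        mu T X (Tmap T (Zob E T X) (Tob T X) (Zincl E T X) w) \<in> E (Zob E T X)) \<and>
     (\<forall>X Y. \<forall>x \<in> E X. \<forall>t \<in> E (Zob E T Y). str T X Y (pair E x t) \<in> E (Zob E T (prod_set E X Y))) \<and>
     is_strong_monad (Sets E) (Zmonad E T) \<and>
     is_commutative_monad (Sets E) (Zmonad E T) \<and>
     is_strong_monad_morphism (Sets E) (Zmonad E T) T (Zincl E T) \<and>
     (\<forall>X. is_mono (Sets E) (Zob E T X) (Tob T X) (Zincl E T X)) \<and>
     is_strong_monad_mono (Sets E) (Zmonad E T) T (Zincl E T) \<and>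
     is_functor (Kleisli (Sets E) (Zmonad E T)) (Kleisli (Sets E) T)
       (\<lambda>X. X) (\<lambda>X Y f. Comp (Sets E) X (Zob E T Y) (Tob T Y) (Zincl E T Y) f) \<and>
     is_category_isomorphism (Kleisli (Sets E) (Zmonad E T)) (premonoidal_centre (Sets E) T)
       (\<lambda>X. X) (\<lambda>X Y f. Comp (Sets E) X (Zob E T Y) (Tob T Y) (Zincl E T Y) f)"
proof -
  interpret strong_monad_on_sets E T
    using assms by (simp add: strong_monad_on_sets_def strong_monad_on_sets_axioms_def)
  show ?thesis
    unfolding Sets_simps(1)
    by (intro conjI allI ballI Tmap_in_Zob eta_in_Zob str_in_Zob is_strong_monad_Zmonad
        is_commutative_monad_Zmonad is_strong_monad_morphism_Zincl is_mono_Zincl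
        is_strong_monad_mono_Zincl is_functor_Zincl_Kleisli is_category_isomorphism_Zincl)
      \<comment> \<open>This settles the multiplication, which binds the central \<open>w\<close>
        along the identity on \<open>Zob E T X\<close>, whose values are central too.\<close>
      (auto simp: mu_Tmap_Zincl intro: bind_in_Zob)
qed

end
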